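(* Let $n,k$ be positive integers, let $r$ be a non-negative integer with $r<n$, let $\rho=(\rho_1,\dots,\rho_k)$ be integers with $1\le \rho_\ell\le n\le k$ for all $\ell\in[k]$ and $\sum_{\ell\in[k]}\rho_\ell=n^2$, and let $d=(d_1,\dots,d_k)$ be non-negative integers with $\sum_{\ell\in[k]}d_\ell\le n-r$. Let $L$ be an $r\times r$ symmetric $\rho$-latin rectangle, and let $e_\ell$ be the number of occurrences of $\ell$ in $L$ for $\ell\in[k]$. Then $L$ can be completed to an $n\times n$ symmetric $\rho$-latin square with prescribed diagonal tail $d$ if and only if $L$ is $(\rho,d)$-admissible and, for all $I\subseteq[r]$ and all $K\subseteq[k]$ (with $\bar K=[k]\setminus K$), $$(n-r)(r-|I|)+\sum_{\ell\in\bar K}\left\lfloor\frac{\rho_\ell-e_\ell-d_\ell}{2}\right\rfloor\ \ge\ \sum_{\ell\in K}\max\{0,\ \rho_\ell-e_\ell-n+r-\mu_I(\ell)\}+\sum_{i\in I}\max\{0,\ n-r-\mu_K(i)\}.$$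
   Context: $[m]=\{1,\dots,m\}$. An $r\times r$ $\rho$-latin rectangle is an $r\times r$ array, every cell of which is filled with a symbol from $[k]$, such that each symbol occurs at most once in each row and at most once in each column, and each symbol $\ell\in[k]$ occurs at most $\rho_\ell$ times in the array. An $n\times n$ $\rho$-latin square is an $n\times n$ array, every cell filled with a symbol from $[k]$, such that each symbol occurs at most once in each row and at most once in each column, and each symbol $\ell\in[k]$ occurs exactly $\rho_\ell$ times. An array $A$ is symmetric if $A_{ij}=A_{ji}$ for all $i,j$. $L$ can be completed (extended, embedded) to an $n\times n$ array $L'$ means that $L$ is the top left $r\times r$ subarray of $L'$. $L'$ has prescribed diagonal tail $d$ means that each symbol $\ell\in[k]$ occurs at least $d_\ell$ times among the entries $L'_{ii}$, $r+1\le i\le n$. For $I\subseteq[r]$ and $\ell\in[k]$, $\mu_I(\ell)$ is the number of rows $i\in I$ of $L$ in which symbol $\ell$ does not occur. For $K\subseteq[k]$ and $i\in[r]$, $\mu_K(i)$ is the number of symbols in $K$ that do not occur in row $i$ of $L$. $L$ is $(\rho,d)$-admissible if all of the following hold: (1) $\rho_\ell-e_\ell+d_\ell\le 2(n-r)$ for all $\ell\in[k]$; (2) $|\{\ell\in[k]:\rho_\ell-e_\ell\not\equiv d_\ell \pmod 2\}|\le n-r-\sum_{\ell\in[k]}d_\ell$; (3) $n-r-\sum_{\ell\in[k]}d_\ell\equiv\sum_{\ell\in[k]}(\rho_\ell-e_\ell-d_\ell)\equiv|\{\ell\in[k]:\rho_\ell-e_\ell\not\equiv d_\ell\pmod 2\}|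 \pmod 2$. *)

theory Defs
  imports "HOL-Number_Theory.Cong"
begin

text \<open>
  An \<open>m\<close> by \<open>m\<close> array is a function \<open>A :: nat \<Rightarrow> nat \<Rightarrow> nat\<close> of which only the entries \<open>A i j\<close>
  with \<open>i, j \<in> {1..m}\<close> matter; values outside this range are never inspected.  Symbols are the
  elements of \<open>{1..k}\<close>.
\<close>

type_synonym array = "nat \<Rightarrow> nat \<Rightarrow> nat"

definition occurrences :: "nat \<Rightarrow> array \<Rightarrow> nat \<Rightarrow> nat" where
  "occurrences m A l = card {(i, j). i \<in> {1..m} \<and> j \<in> {1..m} \<and> A i j = l}"

definition latin_array :: "nat \<Rightarrow> nat \<Rightarrow> array \<Rightarrow> bool" where
  "latin_array m k A \<longleftrightarrow>
     (\<forall>i\<in>{1..m}. \<forall>j\<in>{1..m}. A i j \<in> {1..k}) \<and>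
     (\<forall>l\<in>{1..k}. \<forall>i\<in>{1..m}. card {j \<in> {1..m}. A i j = l} \<le> 1) \<and>
     (\<forall>l\<in>{1..k}. \<forall>j\<in>{1..m}. card {i \<in> {1..m}. A i j = l} \<le> 1)"

definition rho_latin_rectangle :: "nat \<Rightarrow> nat \<Rightarrow> (nat \<Rightarrow> nat) \<Rightarrow> array \<Rightarrow> bool" where
  "rho_latin_rectangle r k \<rho> A \<longleftrightarrow>
     latin_array r k A \<and> (\<forall>l\<in>{1..k}. occurrences r A l \<le> \<rho> l)"

definition rho_latin_square :: "nat \<Rightarrow> nat \<Rightarrow> (nat \<Rightarrow> nat) \<Rightarrow> array \<Rightarrow> bool" where
  "rho_latin_square n k \<rho> A \<longleftrightarrow>
     latin_array n k A \<and> (\<forall>l\<in>{1..k}. occurrences n A l = \<rho> l)"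

definition symmetric_array :: "nat \<Rightarrow> array \<Rightarrow> bool" where
  "symmetric_array m A \<longleftrightarrow> (\<forall>i\<in>{1..m}. \<forall>j\<in>{1..m}. A i j = A j i)"

definition top_left_subarray :: "nat \<Rightarrow> array \<Rightarrow> array \<Rightarrow> bool" where
  "top_left_subarray r L L' \<longleftrightarrow> (\<forall>i\<in>{1..r}. \<forall>j\<in>{1..r}. L' i j = L i j)"

definition prescribed_diagonal_tail ::
    "nat \<Rightarrow> nat \<Rightarrow> nat \<Rightarrow> (nat \<Rightarrow> nat) \<Rightarrow> array \<Rightarrow> bool" where
  "prescribed_diagonal_tail n k r d L' \<longleftrightarrow>
     (\<forall>l\<in>{1..k}. d l \<le> card {i \<in> {r+1..n}. L' i i = l})"

definition rows_missing :: "nat \<Rightarrow> array \<Rightarrow> nat set \<Rightarrow> nat \<Rightarrow> nat" where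
  \<comment> \<open>\<open>\<mu>\<^sub>I(l)\<close>\<close>
  "rows_missing r L I l = card {i \<in> I. \<forall>j\<in>{1..r}. L i j \<noteq> l}"

definition symbols_missing :: "nat \<Rightarrow> array \<Rightarrow> nat set \<Rightarrow> nat \<Rightarrow> nat" where
  \<comment> \<open>\<open>\<mu>\<^sub>K(i)\<close>\<close>
  "symbols_missing r L K i = card {l \<in> K. \<forall>j\<in>{1..r}. L i j \<noteq> l}"

text \<open>
  All differences are taken in \<^typ>\<open>int\<close>; \<open>\<rho> l - e l - d l\<close> may be negative.  On \<^typ>\<open>int\<close>,
  \<open>x div 2\<close> is the floor of \<open>x / 2\<close> also for negative \<open>x\<close>.
\<close>

definition odd_symbols ::
    "nat \<Rightarrow> nat \<Rightarrow> (nat \<Rightarrow> nat) \<Rightarrow> (nat \<Rightarrow> nat) \<Rightarrow> array \<Rightarrow> nat set" where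
  "odd_symbols k r \<rho> d L =
     {l \<in> {1..k}. \<not> [int (\<rho> l) - int (occurrences r L l) = int (d l)] (mod 2)}"

definition admissible ::
    "nat \<Rightarrow> nat \<Rightarrow> nat \<Rightarrow> (nat \<Rightarrow> nat) \<Rightarrow> (nat \<Rightarrow> nat) \<Rightarrow> array \<Rightarrow> bool" where
  "admissible n k r \<rho> d L \<longleftrightarrow>
     (\<forall>l\<in>{1..k}. int (\<rho> l) - int (occurrences r L l) + int (d l) \<le> 2 * (int n - int r)) \<and>
     int (card (odd_symbols k r \<rho> d L)) \<le> int n - int r - (\<Sum>l\<in>{1..k}. int (d l)) \<and>
     [int n - int r - (\<Sum>l\<in>{1..k}. int (d l)) =
        (\<Sum>l\<in>{1..k}. int (\<rho> l) - int (occurrences r L l) - int (d l))] (mod 2) \<and>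
     [(\<Sum>l\<in>{1..k}. int (\<rho> l) - int (occurrences r L l) - int (d l)) =
        int (card (odd_symbols k r \<rho> d L))] (mod 2)"

end

theory Submission
  imports Defs
begin

text \<open>
  Let \<open>m = n - r\<close>.  If row \<open>i\<close> of \<open>L\<close> is continued by the set \<open>F i\<close> of \<open>m\<close> missing symbols and
  symbol \<open>l\<close> lies in \<open>a l\<close> of these sets, then \<open>l\<close> fills \<open>c l = \<rho> l - e l - 2 * a l\<close> cells of the
  bottom right block.  Hence \<open>d l \<le> c l\<close>, and \<open>a l + c l \<le> m\<close> since each new column holds \<open>l\<close> at
  most once; that is, \<open>\<rho> l - e l - m \<le> a l \<le> (\<rho> l - e l - d l) div 2\<close>.  By a theorem of Hoffman
  type, sets \<open>F i\<close> with these bounds exist exactly if the displayed inequalities hold.  Conversely,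
  admissibility lets the diagonal be filled (in each symbol the number of diagonal cells has the
  parity of \<open>c l\<close>), and the new columns can then be split off one at a time.
\<close>

section \<open>Degree-constrained subgraphs of bipartite graphs\<close>

lemma card_prod_split:
  assumes "finite E"
  shows "card (E \<inter> I \<times> K) = (\<Sum>e\<in>E. of_bool (fst e \<in> I \<and> snd e \<in> K))"
proof -
  have "E \<inter> I \<times> K = {e\<in>E. fst e \<in> I \<and> snd e \<in> K}" by auto
  with assms show ?thesis by (simp add: sum.If_cases of_bool_def Int_def)
qed

text \<open>The inequality already holds edge by edge. The two sides move in opposite directions,
  one intersected while the other is united; this is how pairs of cut conditions are uncrossed
  below.\<close>

lemma card_prod_submodular:
  assumes "finite E"
  shows "card (E \<inter> (I \<inter> I') \<times> (K \<union> K')) + card (E \<inter> (I \<union> I') \<times> (K \<inter> K'))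
           \<le> card (E \<inter> I \<times> K) + card (E \<inter> I' \<times> K')"
  unfolding card_prod_split[OF assms] sum.distrib[symmetric]
  by (rule sum_mono) auto

text \<open>
  Every edge is either deleted or selected (which lowers all the bounds at its two ends by one).
  If neither preserved the hypotheses, there would be two tight pairs of sets, and uncrossing
  them would violate a hypothesis.
\<close>

lemma degree_constrained_subgraph:
  fixes p :: "'a \<Rightarrow> int" and lo up :: "'b \<Rightarrow> int"
  assumes "finite E" and "finite A" and "finite B" and "E \<subseteq> A \<times> B"
    and "\<And>b. b \<in> B \<Longrightarrow> lo b \<le> up b"
    and "\<And>I K. I \<subseteq> A \<Longrightarrow> K \<subseteq> B \<Longrightarrow> sum p I \<le> int (card (E \<inter> I \<times> K)) + sum up (B - K)"
    and "\<And>I K. I \<subseteq> A \<Longrightarrow> K \<subseteq> B \<Longrightarrow> sum lo K \<le> sum p (A - I) + int (card (E \<inter> I \<times> K))"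
  shows "\<exists>G\<subseteq>E. (\<forall>a\<in>A. int (card {b. (a, b) \<in> G}) = p a) \<and>
                (\<forall>b\<in>B. lo b \<le> int (card {a. (a, b) \<in> G}) \<and> int (card {a. (a, b) \<in> G}) \<le> up b)"
  using assms
proof (induction E arbitrary: p lo up rule: finite_induct)
  case empty
  \<comment> \<open>With no edges left, the conditions at a single vertex or at the complement of
    one give \<open>lo b <= 0 <= up b\<close> and \<open>p a = 0\<close>, so the empty graph
    serves.\<close>
  have up0: "0 \<le> up b" if "b \<in> B" for b
    using empty(5)[of "{}" "B - {b}"] that by (auto simp: Diff_Diff_Int)
  have p0: "p a = 0" if "a \<in> A" for a
    using empty(5)[of "{a}" B] empty(6)[of "A - {a}" "{}"] that by (auto simp: Diff_Diff_Int)
  have lo0: "lo b \<le> 0" if "b \<in> B" for b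
    using empty(6)[of A "{b}"] that by auto
  show ?case using up0 p0 lo0 by auto
next
  case (insert e E)
  obtain a b where e: "e = (a, b)" by force
  have ab: "a \<in> A" "b \<in> B" and EAB: "E \<subseteq> A \<times> B" using insert.prems(3) e by auto
  have fA: "finite A" and fB: "finite B" using insert.prems by auto
  have ci: "int (card (insert e E \<inter> I \<times> K)) = int (card (E \<inter> I \<times> K)) + of_bool (a \<in> I \<and> b \<in> K)" for I K
    using insert.hyps e by (auto simp: Int_insert_left)
  \<comment> \<open>\<open>f\<close> and \<open>g\<close> are the slacks of the two families of
    conditions in the graph without \<open>e\<close>. The hypotheses also count \<open>e\<close>, so
    a slack can be negative only if \<open>a\<close> is in \<open>I\<close> and \<open>b\<close> is
    in \<open>K\<close>, and then it is -1.\<close>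
  define f where "f I K = int (card (E \<inter> I \<times> K)) + sum up (B - K) - sum p I" for I K
  define g where "g I K = int (card (E \<inter> I \<times> K)) + sum p (A - I) - sum lo K" for I K
  have f0: "f I K + of_bool (a \<in> I \<and> b \<in> K) \<ge> 0" if "I \<subseteq> A" "K \<subseteq> B" for I K
    using insert.prems(5)[OF that] ci[of I K] by (simp add: f_def)
  have g0: "g I K + of_bool (a \<in> I \<and> b \<in> K) \<ge> 0" if "I \<subseteq> A" "K \<subseteq> B" for I K
    using insert.prems(6)[OF that] ci[of I K] by (simp add: g_def)
  have sm: "int (card (E \<inter> (I \<inter> I') \<times> (K \<union> K'))) + int (card (E \<inter> (I \<union> I') \<times> (K \<inter> K')))
           \<le> int (card (E \<inter> I \<times> K)) + int (card (E \<inter> I' \<times> K'))" for I I' K K'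
    using card_prod_submodular[OF insert.hyps(1), of I I' K K'] by linarith
  have modI: "sum h (I \<inter> I') + sum h (I \<union> I') = sum h I + sum h I'"
    if "finite I" "finite I'" for h :: "'c \<Rightarrow> int" and I I'
    using sum.union_inter[OF that, of h] by simp
  have cmp: "sum h (X - I) = sum h X - sum h I"
    if "finite X" "I \<subseteq> X" for h :: "'c \<Rightarrow> int" and I X
    using sum_diff[OF that, of h] .
  have ff: "f (I \<inter> I') (K \<union> K') + f (I \<union> I') (K \<inter> K') \<le> f I K + f I' K'"
    if "I \<subseteq> A" "I' \<subseteq> A" "K \<subseteq> B" "K' \<subseteq> B" for I I' K K'
  proof -
    have fin: "finite I" "finite I'" "finite K" "finite K'"
      using that fA fB finite_subset by metis+
    have "K \<union> K' \<subseteq> B" "K \<inter> K' \<subseteq> B" using that by auto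
    then show ?thesis
      using sm[of I I' K K'] modI[OF fin(1,2), of p] modI[OF fin(3,4), of up] that
      by (simp add: f_def cmp[OF fB])
  qed
  have gg: "g (I \<inter> I') (K \<union> K') + g (I \<union> I') (K \<inter> K') \<le> g I K + g I' K'"
    if "I \<subseteq> A" "I' \<subseteq> A" "K \<subseteq> B" "K' \<subseteq> B" for I I' K K'
  proof -
    have fin: "finite I" "finite I'" "finite K" "finite K'"
      using that fA fB finite_subset by metis+
    have "I \<union> I' \<subseteq> A" "I \<inter> I' \<subseteq> A" using that by auto
    then show ?thesis
      using sm[of I I' K K'] modI[OF fin(1,2), of p] modI[OF fin(3,4), of lo] that
      by (simp add: g_def cmp[OF fA])
  qed
  \<comment> \<open>Apart from the edge counts, mixed uncrossing changes the sum of the slacks by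
    \<open>sum lo (K' - K) - sum up (K' - K)\<close>, which is where \<open>lo <= up\<close>
    enters.\<close>
  have fg: "f (I \<inter> I') (K \<union> K') + g (I \<union> I') (K \<inter> K') \<le> f I K + g I' K'"
    if "I \<subseteq> A" "I' \<subseteq> A" "K \<subseteq> B" "K' \<subseteq> B" for I I' K K'
  proof -
    have fin: "finite I" "finite I'" "finite K" "finite K'"
      using that fA fB finite_subset by metis+
    have sub: "I \<union> I' \<subseteq> A" "I \<inter> I' \<subseteq> A" "K \<union> K' \<subseteq> B" "K \<inter> K' \<subseteq> B" using that by auto
    have "sum lo (K' - K) \<le> sum up (K' - K)"
      using that insert.prems(4) by (intro sum_mono) auto
    moreover have "sum up (K \<union> K') = sum up K + sum up (K' - K)"
      using fin by (metis Diff_disjoint Un_Diff_cancel finite_Diff sum.union_disjoint)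
    moreover have "sum lo K' = sum lo (K \<inter> K') + sum lo (K' - K)"
      using fin by (metis Int_commute sum.Int_Diff)
    ultimately show ?thesis
      using sm[of I I' K K'] modI[OF fin(1,2), of p] that sub
      by (simp add: f_def g_def cmp[OF fA] cmp[OF fB])
  qed
  \<comment> \<open>The edge \<open>(a, b)\<close> makes uncrossing strict.\<close>
  have strict:
    "f I K + f I' K' \<ge> 0" "g I K + g I' K' \<ge> 0" "f I K + g I' K' \<ge> 0" "f I' K' + g I K \<ge> 0"
    if "I \<subseteq> A" "I' \<subseteq> A" "K \<subseteq> B" "K' \<subseteq> B" "a \<notin> I'" "b \<notin> K'" for I I' K K'
  proof -
    have s: "I \<inter> I' \<subseteq> A" "K \<union> K' \<subseteq> B" "I \<union> I' \<subseteq> A" "K \<inter> K' \<subseteq> B" using that by auto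
    show "f I K + f I' K' \<ge> 0" 
      using ff[OF that(1-4)] f0[OF s(1,2)] f0[OF s(3,4)] that by simp
    show "g I K + g I' K' \<ge> 0" 
      using gg[OF that(1-4)] g0[OF s(1,2)] g0[OF s(3,4)] that by simp
    show "f I K + g I' K' \<ge> 0" 
      using fg[OF that(1-4)] f0[OF s(1,2)] g0[OF s(3,4)] that by simp
    show "f I' K' + g I K \<ge> 0" 
      using fg[OF that(2,1,4,3)] f0[OF s(1,2)] g0[OF s(3,4)] that by (simp add: Int_commute Un_commute)
  qed
  \<comment> \<open>Deletion fails only if some slack is negative; \<open>strict\<close> then makes
    every slack at a pair avoiding both \<open>a\<close> and \<open>b\<close> at least 1.\<close>
  consider (delete) "\<And>I K. I \<subseteq> A \<Longrightarrow> K \<subseteq> B \<Longrightarrow> f I K \<ge> 0 \<and> g I K \<ge> 0"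
    | (select) "\<And>I K. I \<subseteq> A \<Longrightarrow> K \<subseteq> B \<Longrightarrow> a \<notin> I \<Longrightarrow> b \<notin> K \<Longrightarrow> f I K \<ge> 1 \<and> g I K \<ge> 1"
  proof -
    { fix I K I' K'
      assume "I \<subseteq> A" "K \<subseteq> B" "\<not> (f I K \<ge> 0 \<and> g I K \<ge> 0)" "I' \<subseteq> A" "K' \<subseteq> B" "a \<notin> I'" "b \<notin> K'"
      then have "f I' K' \<ge> 1 \<and> g I' K' \<ge> 1"
        using strict[of I I' K K'] by linarith }
    then show thesis using that by blast
  qed
  then show ?case
  proof cases
    case delete
    have "\<exists>G\<subseteq>E. (\<forall>a\<in>A. int (card {b. (a, b) \<in> G}) = p a) \<and>
                (\<forall>b\<in>B. lo b \<le> int (card {a. (a, b) \<in> G}) \<and> int (card {a. (a, b) \<in> G}) \<le> up b)"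
    proof (intro insert.IH fA fB EAB insert.prems(4))
      fix I K assume "I \<subseteq> A" "K \<subseteq> B"
      from delete[OF this]
      show "sum p I \<le> int (card (E \<inter> I \<times> K)) + sum up (B - K)"
        and "sum lo K \<le> sum p (A - I) + int (card (E \<inter> I \<times> K))"
        by (simp_all add: f_def g_def)
    qed
    then show ?thesis by blast
  next
    case select
    \<comment> \<open>Selecting \<open>e\<close> changes each slack by
      \<open>of_bool (a \<in> I) + of_bool (b \<in> K) - 1\<close>. Pairs avoiding both ends lose 1,
      which \<open>select\<close> provides; pairs containing both gain 1, which makes up for a slack
      of -1.\<close>
    define p' where "p' = p(a := p a - 1)"
    define lo' where "lo' = lo(b := lo b - 1)"
    define up' where "up' = up(b := up b - 1)"
    have upd: "sum (h(x := h x - 1)) X = sum h X - of_bool (x \<in> X)"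
      if "finite X" for h :: "'c \<Rightarrow> int" and x X
    proof -
      have "sum (h(x := h x - 1)) X = (\<Sum>y\<in>X. h y - of_bool (y = x))"
        by (rule sum.cong) auto
      also have "\<dots> = sum h X - of_bool (x \<in> X)"
        using that by (simp add: sum_subtractf of_bool_def sum.delta)
      finally show ?thesis .
    qed
    have "\<exists>G\<subseteq>E. (\<forall>x\<in>A. int (card {y. (x, y) \<in> G}) = p' x) \<and>
                (\<forall>y\<in>B. lo' y \<le> int (card {x. (x, y) \<in> G}) \<and> int (card {x. (x, y) \<in> G}) \<le> up' y)"
    proof (intro insert.IH fA fB EAB)
      show "lo' y \<le> up' y" if "y \<in> B" for y
        using insert.prems(4)[OF that] by (cases "y = b") (simp_all add: lo'_def up'_def)
    next
      fix I K assume s: "I \<subseteq> A" "K \<subseteq> B"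
      then have fin: "finite I" "finite (B - K)" "finite (A - I)" "finite K" using fA fB finite_subset by blast+
      show "sum p' I \<le> int (card (E \<inter> I \<times> K)) + sum up' (B - K)"
        using f0[OF s] select[OF s] ab
          upd[OF fin(1), of p a] upd[OF fin(2), of up b]
        by (cases "a \<in> I"; cases "b \<in> K") (simp_all add: p'_def up'_def f_def del: fun_upd_apply)
      show "sum lo' K \<le> sum p' (A - I) + int (card (E \<inter> I \<times> K))"
        using g0[OF s] select[OF s] ab
          upd[OF fin(3), of p a] upd[OF fin(4), of lo b]
        by (cases "a \<in> I"; cases "b \<in> K") (simp_all add: p'_def lo'_def g_def del: fun_upd_apply)
    qed
    then obtain G where G: "G \<subseteq> E" "\<And>x. x \<in> A \<Longrightarrow> int (card {y. (x, y) \<in> G}) = p' x"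
      "\<And>y. y \<in> B \<Longrightarrow> lo' y \<le> int (card {x. (x, y) \<in> G}) \<and> int (card {x. (x, y) \<in> G}) \<le> up' y"
      by blast
    have finG: "finite G" using G(1) insert.hyps finite_subset by blast
    have nin: "(a, b) \<notin> G" using G(1) insert.hyps e by auto
    have fin1: "finite {y. (x, y) \<in> G}" for x
      using finite_subset[of "{y. (x, y) \<in> G}" "snd ` G"] finG by force
    have fin2: "finite {x. (x, y) \<in> G}" for y
      using finite_subset[of "{x. (x, y) \<in> G}" "fst ` G"] finG by force
    have c1: "int (card {y. (x, y) \<in> insert e G}) = int (card {y. (x, y) \<in> G}) + of_bool (x = a)" for x
    proof -
      have "{y. (x, y) \<in> insert e G} = (if x = a then insert b {y. (x, y) \<in> G} else {y. (x, y) \<in> G})"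
        using e by auto
      then show ?thesis using fin1 nin by simp
    qed
    have c2: "int (card {x. (x, y) \<in> insert e G}) = int (card {x. (x, y) \<in> G}) + of_bool (y = b)" for y
    proof -
      have "{x. (x, y) \<in> insert e G} = (if y = b then insert a {x. (x, y) \<in> G} else {x. (x, y) \<in> G})"
        using e by auto
      then show ?thesis using fin2 nin by simp
    qed
    show ?thesis
    proof (intro exI[of _ "insert e G"] conjI ballI)
      show "insert e G \<subseteq> insert e E" using G(1) by auto
    next
      fix x assume "x \<in> A"
      from G(2)[OF this] show "int (card {y. (x, y) \<in> insert e G}) = p x" 
        unfolding c1 by (simp add: p'_def split: if_splits)
    next
      fix y assume "y \<in> B"
      note G(3)[OF this]
      then show "lo y \<le> int (card {x. (x, y) \<in> insert e G})" "int (card {x. (x, y) \<in> insert e G}) \<le> up y"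
        unfolding c2 by (simp_all add: lo'_def up'_def split: if_splits)
    qed
  qed
qed

text \<open>Dividing by \<open>M\<close> turns \<open>w\<close> into a fractional subgraph of its
  support, with degree \<open>p a\<close> at each \<open>a\<close> and at most 1 at each
  \<open>b\<close>. Its existence forces the cut conditions of
  \<open>degree_constrained_subgraph\<close>, with lower bound 1 at the \<open>b\<close> whose
  column sum is \<open>M\<close> and 0 elsewhere, and that lemma returns an integral
  subgraph.\<close>

lemma integral_subgraph:
  fixes w :: "'a \<Rightarrow> 'b \<Rightarrow> nat" and p :: "'a \<Rightarrow> nat"
  assumes "finite A" and "finite B" and "0 < M"
    and row: "\<And>a. a \<in> A \<Longrightarrow> (\<Sum>b\<in>B. w a b) = M * p a"
    and col: "\<And>b. b \<in> B \<Longrightarrow> (\<Sum>a\<in>A. w a b) \<le> M"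
  shows "\<exists>G\<subseteq>A \<times> B. (\<forall>(a, b)\<in>G. 0 < w a b) \<and> (\<forall>a\<in>A. card {b. (a, b) \<in> G} = p a) \<and>
           (\<forall>b\<in>B. card {a. (a, b) \<in> G} \<le> 1 \<and> ((\<Sum>a\<in>A. w a b) = M \<longrightarrow> card {a. (a, b) \<in> G} = 1))"
proof -
  define E where "E = {e \<in> A \<times> B. 0 < w (fst e) (snd e)}"
  have finE: "finite E" unfolding E_def using assms(1,2) by simp
  have wM: "w a b \<le> M" if "a \<in> A" "b \<in> B" for a b
    using member_le_sum[of a A "\<lambda>a. w a b"] col[OF that(2)] that(1) assms(1) by simp
  have wE: "(\<Sum>a\<in>I. \<Sum>b\<in>K. w a b) \<le> M * card (E \<inter> I \<times> K)" if "I \<subseteq> A" "K \<subseteq> B" for I K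
  proof -
    have fin: "finite (I \<times> K)"
      using that assms(1,2) by (auto intro: finite_cartesian_product finite_subset)
    have "(\<Sum>a\<in>I. \<Sum>b\<in>K. w a b) = (\<Sum>e\<in>I \<times> K. w (fst e) (snd e))"
      by (simp only: sum.cartesian_product case_prod_unfold)
    also have "\<dots> \<le> (\<Sum>e\<in>I \<times> K. M * of_bool (e \<in> E))"
      using that wM by (intro sum_mono) (fastforce simp: E_def)
    also have "\<dots> = M * (\<Sum>e\<in>I \<times> K. of_bool (e \<in> E))"
      by (simp add: sum_distrib_left)
    also have "(\<Sum>e\<in>I \<times> K. of_bool (e \<in> E) :: nat) = card (E \<inter> I \<times> K)"
      using fin by (simp add: of_bool_def sum.If_cases Int_commute)
    finally show ?thesis .
  qed
  define lo :: "'b \<Rightarrow> nat" where "lo b = of_bool ((\<Sum>a\<in>A. w a b) = M)" for b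
  have "\<exists>G\<subseteq>E. (\<forall>a\<in>A. int (card {b. (a, b) \<in> G}) = int (p a)) \<and>
                (\<forall>b\<in>B. int (lo b) \<le> int (card {a. (a, b) \<in> G}) \<and> int (card {a. (a, b) \<in> G}) \<le> 1)"
  proof (rule degree_constrained_subgraph[OF finE assms(1,2)])
    show "E \<subseteq> A \<times> B" by (auto simp: E_def)
    show "int (lo b) \<le> 1" for b by (simp add: lo_def)
  next
    fix I K assume s: "I \<subseteq> A" "K \<subseteq> B"
    have fin: "finite I" "finite K" using s assms(1,2) by (auto intro: finite_subset)
    \<comment> \<open>The weight leaving \<open>I\<close> enters \<open>K\<close>, at most
      \<open>M\<close> per edge of the support, or enters \<open>B - K\<close>, at most
      \<open>M\<close> per vertex. Dividing by \<open>M\<close> gives the first cut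
      condition.\<close>
    have "M * sum p I = (\<Sum>a\<in>I. \<Sum>b\<in>B. w a b)"
      using s row by (simp add: sum_distrib_left subset_iff)
    also have "\<dots> = (\<Sum>a\<in>I. \<Sum>b\<in>K. w a b) + (\<Sum>a\<in>I. \<Sum>b\<in>B - K. w a b)"
      by (simp only: sum.subset_diff[OF s(2) assms(2)] sum.distrib add.commute)
    also have "(\<Sum>a\<in>I. \<Sum>b\<in>B - K. w a b) = (\<Sum>b\<in>B - K. \<Sum>a\<in>I. w a b)"
      by (rule sum.swap)
    also have "\<dots> \<le> (\<Sum>b\<in>B - K. M)"
    proof (rule sum_mono)
      fix b assume "b \<in> B - K"
      then show "(\<Sum>a\<in>I. w a b) \<le> M"
        using sum_mono2[OF assms(1) s(1), of "\<lambda>a. w a b"] col[of b] by simp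
    qed
    also have "\<dots> = M * card (B - K)" by simp
    finally have "M * sum p I \<le> M * (card (E \<inter> I \<times> K) + card (B - K))"
      using wE[OF s] by (simp add: distrib_left)
    then have "sum p I \<le> card (E \<inter> I \<times> K) + card (B - K)" using assms(3) by simp
    then have "int (sum p I) \<le> int (card (E \<inter> I \<times> K) + card (B - K))" by (rule of_nat_mono)
    then show "(\<Sum>a\<in>I. int (p a)) \<le> int (card (E \<inter> I \<times> K)) + (\<Sum>b\<in>B - K. 1)" by simp
  next
    fix I K assume s: "I \<subseteq> A" "K \<subseteq> B"
    have fin: "finite I" "finite K" using s assms(1,2) by (auto intro: finite_subset)
    \<comment> \<open>Each saturated vertex of \<open>K\<close> receives weight \<open>M\<close>.
      What comes from \<open>I\<close> is at most \<open>M\<close> per edge, and what comes from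
      \<open>A - I\<close> is at most the whole weight \<open>M * p a\<close> of each row
      there.\<close>
    have "M * sum lo K = (\<Sum>b\<in>K. M * lo b)" by (simp add: sum_distrib_left)
    also have "\<dots> \<le> (\<Sum>b\<in>K. \<Sum>a\<in>A. w a b)"
      by (intro sum_mono) (auto simp: lo_def)
    also have "\<dots> = (\<Sum>b\<in>K. (\<Sum>a\<in>I. w a b) + (\<Sum>a\<in>A - I. w a b))"
      by (simp only: sum.subset_diff[OF s(1) assms(1)] add.commute)
    also have "\<dots> = (\<Sum>a\<in>I. \<Sum>b\<in>K. w a b) + (\<Sum>a\<in>A - I. \<Sum>b\<in>K. w a b)"
      unfolding sum.distrib sum.swap[of _ _ K] ..
    also have "(\<Sum>a\<in>A - I. \<Sum>b\<in>K. w a b) \<le> (\<Sum>a\<in>A - I. M * p a)"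
    proof (rule sum_mono)
      fix a assume "a \<in> A - I"
      then show "(\<Sum>b\<in>K. w a b) \<le> M * p a"
        using sum_mono2[OF assms(2) s(2), of "\<lambda>b. w a b"] row[of a] by simp
    qed
    also have "\<dots> = M * sum p (A - I)" by (simp add: sum_distrib_left)
    finally have "M * sum lo K \<le> M * (sum p (A - I) + card (E \<inter> I \<times> K))"
      using wE[OF s] by (simp add: distrib_left)
    then have "sum lo K \<le> sum p (A - I) + card (E \<inter> I \<times> K)" using assms(3) by simp
    then have "int (sum lo K) \<le> int (sum p (A - I) + card (E \<inter> I \<times> K))" by (rule of_nat_mono)
    then show "(\<Sum>b\<in>K. int (lo b)) \<le> (\<Sum>a\<in>A - I. int (p a)) + int (card (E \<inter> I \<times> K))" by simp
  qed
  then obtain G where "G \<subseteq> E" "\<forall>a\<in>A. card {b. (a, b) \<in> G} = p a"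
    "\<forall>b\<in>B. lo b \<le> card {a. (a, b) \<in> G} \<and> card {a. (a, b) \<in> G} \<le> 1" by auto
  then show ?thesis
    by (intro exI[of _ G]) (fastforce simp: E_def lo_def)
qed

section \<open>Latin arrays and occurrence counts\<close>

lemma latin_array_iff:
  "latin_array m k A \<longleftrightarrow>
     (\<forall>i\<in>{1..m}. \<forall>j\<in>{1..m}. A i j \<in> {1..k}) \<and>
     (\<forall>i\<in>{1..m}. inj_on (A i) {1..m}) \<and> (\<forall>j\<in>{1..m}. inj_on (\<lambda>i. A i j) {1..m})"
proof -
  \<comment> \<open>The cardinality conditions speak of symbols in \<open>{1..k}\<close> only, so
    deducing injectivity from them uses that all entries lie in this range.\<close>
  have *: "(\<forall>l\<in>{1..k}. card {j \<in> {1..m}. f j = l} \<le> 1) \<longleftrightarrow> inj_on f {1..m}"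
    if "\<forall>j\<in>{1..m}. f j \<in> {1..k}" for f :: "nat \<Rightarrow> nat"
  proof
    assume le: "\<forall>l\<in>{1..k}. card {j \<in> {1..m}. f j = l} \<le> 1"
    show "inj_on f {1..m}"
    proof (rule inj_onI)
      fix x y assume xy: "x \<in> {1..m}" "y \<in> {1..m}" "f x = f y"
      with le that have "card {j \<in> {1..m}. f j = f x} \<le> Suc 0" by simp
      then show "x = y" using xy by (subst (asm) card_le_Suc0_iff_eq) auto
    qed
  next
    assume inj: "inj_on f {1..m}"
    have "card {j \<in> {1..m}. f j = l} \<le> Suc 0" for l
    proof -
      have "\<forall>x\<in>{j \<in> {1..m}. f j = l}. \<forall>y\<in>{j \<in> {1..m}. f j = l}. x = y"
        by (intro ballI, rule inj_onD[OF inj]) auto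
      then show ?thesis by (subst card_le_Suc0_iff_eq) simp_all
    qed
    then show "\<forall>l\<in>{1..k}. card {j \<in> {1..m}. f j = l} \<le> 1" by simp
  qed
  show ?thesis
  proof (cases "\<forall>i\<in>{1..m}. \<forall>j\<in>{1..m}. A i j \<in> {1..k}")
    case True
    have "(\<forall>l\<in>{1..k}. card {j \<in> {1..m}. A i j = l} \<le> 1) \<longleftrightarrow> inj_on (A i) {1..m}"
      if "i \<in> {1..m}" for i
      by (rule *) (use True that in blast)
    moreover have "(\<forall>l\<in>{1..k}. card {i \<in> {1..m}. A i j = l} \<le> 1) \<longleftrightarrow>
        inj_on (\<lambda>i. A i j) {1..m}" if "j \<in> {1..m}" for j
      by (rule *) (use True that in blast)
    ultimately show ?thesis unfolding latin_array_def by blast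
  qed (auto simp: latin_array_def)
qed

lemma card_filter_of_bool: "finite S \<Longrightarrow> card {x \<in> S. P x} = (\<Sum>x\<in>S. of_bool (P x))"
  by (simp add: sum.If_cases of_bool_def Int_def)

lemma occurrences_sum: "occurrences m A l = (\<Sum>i\<in>{1..m}. \<Sum>j\<in>{1..m}. of_bool (A i j = l))"
proof -
  have "{(i, j). i \<in> {1..m} \<and> j \<in> {1..m} \<and> A i j = l} =
        {e \<in> {1..m} \<times> {1..m}. A (fst e) (snd e) = l}" by auto
  then show ?thesis
    unfolding occurrences_def
    by (simp only: card_filter_of_bool finite_cartesian_product finite_atLeastAtMost
        sum.cartesian_product case_prod_unfold)
qed

section \<open>Bordering a symmetric array by one row and column at a time\<close>

lemma occurrences_Suc:
  assumes "\<And>i j. i \<in> {1..r} \<Longrightarrow> j \<in> {1..r} \<Longrightarrow> A i j = L i j"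
    and "\<And>i. i \<in> {1..r} \<Longrightarrow> A i (Suc r) = s i" and "\<And>i. i \<in> {1..r} \<Longrightarrow> A (Suc r) i = s i"
  shows "occurrences (Suc r) A l =
    occurrences r L l + 2 * card {i \<in> {1..r}. s i = l} + of_bool (A (Suc r) (Suc r) = l)"
proof -
  have "(\<Sum>i\<in>{1..r}. \<Sum>j\<in>{1..r}. of_bool (A i j = l)) = occurrences r L l"
    unfolding occurrences_sum using assms(1) by (intro sum.cong) auto
  moreover have "(\<Sum>i\<in>{1..r}. of_bool (A i (Suc r) = l)) = card {i \<in> {1..r}. s i = l}"
    unfolding card_filter_of_bool[OF finite_atLeastAtMost] using assms(2) by (intro sum.cong) auto
  moreover have "(\<Sum>i\<in>{1..r}. of_bool (A (Suc r) i = l)) = card {i \<in> {1..r}. s i = l}"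
    unfolding card_filter_of_bool[OF finite_atLeastAtMost] using assms(3) by (intro sum.cong) auto
  ultimately show ?thesis
    unfolding occurrences_sum[of "Suc r"] by (simp add: sum.distrib)
qed

text \<open>
  \<open>F i\<close> is the set of symbols to be placed in row \<open>i\<close> to the right of \<open>L\<close>, while symbol \<open>l\<close> is to
  occupy \<open>D l\<close> diagonal cells and \<open>b l\<close> pairs of opposite off-diagonal cells of the bottom right
  block.  One row and column at a time is added: its entries come from the rows of \<open>L\<close>, its
  diagonal entry from \<open>D\<close>, and its remaining \<open>m\<close> entries from \<open>b\<close>; a degree-balanced subgraph
  ensures that every symbol that fills up all the remaining columns gets used.
\<close>

lemma symmetric_completion:
  fixes F :: "nat \<Rightarrow> nat set"
  assumes "latin_array r k L" and "symmetric_array r L"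
    and "\<And>i. i \<in> {1..r} \<Longrightarrow> F i \<subseteq> {1..k}" and "\<And>i. i \<in> {1..r} \<Longrightarrow> card (F i) = m"
    and "\<And>i j. i \<in> {1..r} \<Longrightarrow> j \<in> {1..r} \<Longrightarrow> L i j \<notin> F i"
    and "(\<Sum>l\<in>{1..k}. D l) = m" and "2 * (\<Sum>l\<in>{1..k}. b l) = m * (m - 1)"
    and "\<And>l. l \<in> {1..k} \<Longrightarrow> card {i \<in> {1..r}. l \<in> F i} + 2 * b l + D l \<le> m"
  shows "\<exists>L'. latin_array (r + m) k L' \<and> symmetric_array (r + m) L' \<and> top_left_subarray r L L' \<and>
     (\<forall>l\<in>{1..k}. occurrences (r + m) L' l =
         occurrences r L l + 2 * card {i \<in> {1..r}. l \<in> F i} + 2 * b l + D l \<and>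
       card {i \<in> {r + 1..r + m}. L' i i = l} = D l)"
  using assms
proof (induction m arbitrary: r L F D b)
  case 0
  have "{i \<in> {1..r}. l \<in> F i} = {}" for l
    using 0(3,4) finite_subset[OF 0(3)] by force
  with 0 show ?case
    by (intro exI[of _ L]) (auto simp: top_left_subarray_def)
next
  case (Suc m)
  note latL = Suc.prems(1) and symL = Suc.prems(2) and Fk = Suc.prems(3) and Fcard = Suc.prems(4)
    and FL = Suc.prems(5) and sumD = Suc.prems(6) and sumb = Suc.prems(7) and tot = Suc.prems(8)
  let ?M = "Suc m"
  \<comment> \<open>Left vertices: \<open>i\<close> in \<open>{1..r}\<close> is a row of
    \<open>L\<close>, \<open>0\<close> stands for the diagonal cells still to come, and
    \<open>Suc r\<close> for the off-diagonal cells of the bottom right block, two for each pair.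
    Row sums are \<open>Suc m * p i\<close> and column sums at most \<open>Suc m\<close>, so the
    next column takes a share of one in \<open>Suc m\<close>: one symbol from each row, one for the
    corner and \<open>m\<close> for the cells below it.\<close>
  define w where "w i l = (if i \<in> {1..r} then of_bool (l \<in> F i) else if i = 0 then D l else 2 * b l)"
    for i l :: nat
  define p where "p i = (if i = Suc r then m else 1)" for i
  define A where "A = insert 0 (insert (Suc r) {1..r})"
  have sumA: "sum h A = h 0 + h (Suc r) + sum h {1..r}" for h :: "nat \<Rightarrow> nat"
    by (simp add: A_def)
  have col: "(\<Sum>i\<in>A. w i l) = card {i \<in> {1..r}. l \<in> F i} + 2 * b l + D l" for l
    unfolding sumA card_filter_of_bool[OF finite_atLeastAtMost] by (simp add: w_def)
  have row: "(\<Sum>l\<in>{1..k}. w i l) = ?M * p i" if i: "i \<in> A" for i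
  proof -
    consider "i = 0" | "i = Suc r" | "i \<in> {1..r}" using i by (auto simp: A_def)
    then show ?thesis
    proof cases
      case 1 then show ?thesis using sumD by (simp add: w_def p_def)
    next
      case 2 then show ?thesis using sumb by (simp add: w_def p_def sum_distrib_left)
    next
      case 3
      have "{l \<in> {1..k}. l \<in> F i} = F i" using Fk[OF 3] by auto
      then have "(\<Sum>l\<in>{1..k}. of_bool (l \<in> F i)) = ?M"
        using Fcard[OF 3] card_filter_of_bool[of "{1..k}" "\<lambda>l. l \<in> F i"] by simp
      then show ?thesis using 3 by (simp add: w_def p_def)
    qed
  qed
  have "\<exists>G\<subseteq>A \<times> {1..k}. (\<forall>(a, b)\<in>G. 0 < w a b) \<and> (\<forall>a\<in>A. card {b. (a, b) \<in> G} = p a) \<and>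
      (\<forall>b\<in>{1..k}. card {a. (a, b) \<in> G} \<le> 1 \<and> ((\<Sum>a\<in>A. w a b) = ?M \<longrightarrow> card {a. (a, b) \<in> G} = 1))"
  proof (rule integral_subgraph[OF _ _ _ row])
    show "(\<Sum>i\<in>A. w i l) \<le> ?M" if "l \<in> {1..k}" for l
      unfolding col using tot[OF that] .
  qed (simp_all add: A_def)
  then obtain G where G0: "G \<subseteq> A \<times> {1..k}" "\<forall>(i, l)\<in>G. 0 < w i l" "\<forall>i\<in>A. card {l. (i, l) \<in> G} = p i"
    "\<forall>l\<in>{1..k}. card {i. (i, l) \<in> G} \<le> 1 \<and>
       ((\<Sum>i\<in>A. w i l) = ?M \<longrightarrow> card {i. (i, l) \<in> G} = 1)"
    by (elim exE conjE)
  have G: "G \<subseteq> A \<times> {1..k}" "\<And>i l. (i, l) \<in> G \<Longrightarrow> 0 < w i l"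
    "\<And>i. i \<in> A \<Longrightarrow> card {l. (i, l) \<in> G} = p i"
    "\<And>l. l \<in> {1..k} \<Longrightarrow> card {i. (i, l) \<in> G} \<le> 1"
    "\<And>l. l \<in> {1..k} \<Longrightarrow> (\<Sum>i\<in>A. w i l) = ?M \<Longrightarrow> card {i. (i, l) \<in> G} = 1"
    using G0 by blast+
  have finA: "finite A" by (simp add: A_def)
  have Guniq: "i = i'" if "(i, l) \<in> G" "(i', l) \<in> G" for i i' l
  proof -
    have "finite {i. (i, l) \<in> G}" using G(1) finA by (auto intro: finite_subset[of _ A])
    moreover have "l \<in> {1..k}" using that G(1) by auto
    ultimately show ?thesis using G(4)[of l] that by (auto simp: card_le_Suc0_iff_eq)
  qed
  \<comment> \<open>\<open>s i\<close> is the entry of the new column in row \<open>i\<close>, and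
    \<open>s 0\<close> the corner. The \<open>m\<close> symbols of \<open>\<Lambda>\<close> go below
    the corner; their order is left to the later rounds.\<close>
  define s where "s i = (THE l. (i, l) \<in> G)" for i
  have s: "(i, l) \<in> G \<longleftrightarrow> l = s i" if "i \<in> insert 0 {1..r}" for i l
  proof -
    have "card {l. (i, l) \<in> G} = 1" using G(3)[of i] that by (auto simp: A_def p_def)
    then obtain x where "{l. (i, l) \<in> G} = {x}" by (auto simp: card_1_singleton_iff)
    then have x: "(i, l) \<in> G \<longleftrightarrow> l = x" for l by auto
    then show ?thesis unfolding s_def by simp
  qed
  define \<Lambda> where "\<Lambda> = {l. (Suc r, l) \<in> G}"
  have cL: "card \<Lambda> = m" using G(3)[of "Suc r"] by (simp add: \<Lambda>_def A_def p_def)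
  have LamK: "\<Lambda> \<subseteq> {1..k}" using G(1) by (auto simp: \<Lambda>_def)
  have sk: "s i \<in> {1..k}" if "i \<in> insert 0 {1..r}" for i
    using s[OF that, of "s i"] G(1) by auto
  have sF: "s i \<in> F i" if "i \<in> {1..r}" for i
    using s[of i "s i"] G(2)[of i "s i"] that by (auto simp: w_def split: if_splits)
  have D0: "0 < D (s 0)"
    using s[of 0 "s 0"] G(2)[of 0 "s 0"] by (simp add: w_def)
  have bL: "0 < b l" if "l \<in> \<Lambda>" for l
    using G(2)[of "Suc r" l] that by (simp add: w_def \<Lambda>_def)
  have sinj: "i = i'" if "i \<in> insert 0 {1..r}" "i' \<in> insert 0 {1..r}" "s i = s i'" for i i'
    using Guniq s that by metis
  have sLam: "s i \<notin> \<Lambda>" if "i \<in> insert 0 {1..r}" for i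
    using Guniq[of i "s i" "Suc r"] s[of i "s i"] that by (auto simp: \<Lambda>_def)
  define u where "u l = card {i \<in> {1..r}. s i = l}" for l
  have u: "card {i. (i, l) \<in> G} = u l + of_bool (l = s 0) + of_bool (l \<in> \<Lambda>)" for l
  proof -
    have "{i. (i, l) \<in> G} = {i \<in> A. (i, l) \<in> G}" using G(1) by auto
    then have "card {i. (i, l) \<in> G} = (\<Sum>i\<in>A. of_bool ((i, l) \<in> G))"
      using card_filter_of_bool[OF finA, of "\<lambda>i. (i, l) \<in> G"] by simp
    also have "\<dots> = of_bool (l = s 0) + of_bool (l \<in> \<Lambda>) + (\<Sum>i\<in>{1..r}. of_bool ((i, l) \<in> G))"
      unfolding sumA using s[of 0 l] by (simp add: \<Lambda>_def)
    also have "(\<Sum>i\<in>{1..r}. of_bool ((i, l) \<in> G)) = u l"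
      unfolding u_def card_filter_of_bool[OF finite_atLeastAtMost] using s by (intro sum.cong) auto
    finally show ?thesis by simp
  qed
  define L1 where "L1 i j = (if i \<le> r then if j \<le> r then L i j else s i else if j \<le> r then s j else s 0)"
    for i j
  \<comment> \<open>\<open>\<Lambda>\<close> becomes the set of pending symbols of the new row: a
    symbol in it trades one pair counted by \<open>b\<close> for membership in
    \<open>F1 (Suc r)\<close>. The subtractions in \<open>D1\<close> and \<open>b1\<close> are exact
    because edges of \<open>G\<close> have positive weight.\<close>
  define F1 where "F1 i = (if i \<le> r then F i - {s i} else \<Lambda>)" for i
  define D1 where "D1 l = D l - of_bool (l = s 0)" for l
  define b1 where "b1 l = b l - of_bool (l \<in> \<Lambda>)" for l
  have D1: "D l = D1 l + of_bool (l = s 0)" for l using D0 by (auto simp: D1_def)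
  have b1: "b l = b1 l + of_bool (l \<in> \<Lambda>)" for l using bL[of l] by (auto simp: b1_def)
  have F1c: "card {i \<in> {1..r}. l \<in> F i} + of_bool (l \<in> \<Lambda>) = card {i \<in> {1..Suc r}. l \<in> F1 i} + u l" for l
  proof -
    have "of_bool (l \<in> F i) = (of_bool (l \<in> F1 i) + of_bool (s i = l) :: nat)" if "i \<in> {1..r}" for i
      using sF[OF that] that by (auto simp: F1_def)
    then have "(\<Sum>i\<in>{1..r}. of_bool (l \<in> F i)) = (\<Sum>i\<in>{1..r}. of_bool (l \<in> F1 i)) + u l"
      unfolding u_def card_filter_of_bool[OF finite_atLeastAtMost] sum.distrib[symmetric]
      by (intro sum.cong) auto
    then show ?thesis
      unfolding card_filter_of_bool[OF finite_atLeastAtMost] by (simp add: F1_def)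
  qed
  have symL1: "symmetric_array (Suc r) L1"
    using symL by (auto simp: symmetric_array_def L1_def)
  have injL1: "inj_on (L1 i) {1..Suc r}" if i: "i \<in> {1..Suc r}" for i
  proof (cases "i \<le> r")
    case True
    have "inj_on (L i) {1..r}" using latL i True by (simp add: latin_array_iff)
    then have "inj_on (L1 i) {1..r}"
      using True by (subst inj_on_cong[where g = "L i"]) (simp_all add: L1_def)
    moreover have "L i j \<noteq> s i" if "j \<in> {1..r}" for j
      using FL[of i j] sF[of i] True i that by auto
    then have "L1 i (Suc r) \<notin> L1 i ` {1..r}"
      using True by (force simp: L1_def)
    moreover have "{1..Suc r} = insert (Suc r) {1..r}" "{1..r} - {Suc r} = {1..r}" by auto
    ultimately show ?thesis by (simp only: inj_on_insert simp_thms)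
  next
    case False
    \<comment> \<open>The last row reads \<open>s 1\<close>, ..., \<open>s r\<close>,
      \<open>s 0\<close>, and \<open>sinj\<close> separates all of these symbols, including the
      corner.\<close>
    have "inj_on (\<lambda>j. s (if j \<le> r then j else 0)) {1..Suc r}"
    proof (rule inj_onI)
      fix j j' assume j: "j \<in> {1..Suc r}" "j' \<in> {1..Suc r}"
        and eq: "s (if j \<le> r then j else 0) = s (if j' \<le> r then j' else 0)"
      have "(if j \<le> r then j else 0) = (if j' \<le> r then j' else 0)"
        by (rule sinj[OF _ _ eq]) (use j in simp_all)
      with j show "j = j'" by (simp split: if_splits)
    qed
    moreover have "L1 i = (\<lambda>j. s (if j \<le> r then j else 0))"
      using False by (auto simp: L1_def)
    ultimately show ?thesis by simp
  qed
  have "\<exists>L'. latin_array (Suc r + m) k L' \<and> symmetric_array (Suc r + m) L' \<and> top_left_subarray (Suc r) L1 L' \<and>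
     (\<forall>l\<in>{1..k}. occurrences (Suc r + m) L' l =
         occurrences (Suc r) L1 l + 2 * card {i \<in> {1..Suc r}. l \<in> F1 i} + 2 * b1 l + D1 l \<and>
       card {i \<in> {Suc r + 1..Suc r + m}. L' i i = l} = D1 l)"
  proof (rule Suc.IH[OF _ symL1])
    have "\<forall>i\<in>{1..Suc r}. \<forall>j\<in>{1..Suc r}. L1 i j \<in> {1..k}"
      using latL sk unfolding latin_array_iff L1_def by auto
    moreover have "inj_on (\<lambda>i. L1 i j) {1..Suc r}" if "j \<in> {1..Suc r}" for j
    proof -
      have "L1 i j = L1 j i" if "i \<in> {1..Suc r}" for i
        using symL1 that \<open>j \<in> _\<close> by (simp add: symmetric_array_def)
      then have "inj_on (\<lambda>i. L1 i j) {1..Suc r} \<longleftrightarrow> inj_on (L1 j) {1..Suc r}"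
        by (rule inj_on_cong)
      with injL1[OF that] show ?thesis by blast
    qed
    ultimately show "latin_array (Suc r) k L1"
      using injL1 unfolding latin_array_iff by blast
  next
    fix i assume i: "i \<in> {1..Suc r}"
    show "F1 i \<subseteq> {1..k}" using Fk[of i] LamK i by (auto simp: F1_def)
    show "card (F1 i) = m"
      using cL Fcard[of i] sF[of i] i by (auto simp: F1_def)
    fix j assume j: "j \<in> {1..Suc r}"
    show "L1 i j \<notin> F1 i"
      using FL[of i j] sLam[of j] sLam[of 0] i j by (auto simp: F1_def L1_def)
  next
    have "(\<Sum>l\<in>{1..k}. D l) = (\<Sum>l\<in>{1..k}. D1 l) + 1"
      using sk[of 0] unfolding D1 sum.distrib by (simp add: of_bool_def sum.delta)
    then show "(\<Sum>l\<in>{1..k}. D1 l) = m" using sumD by simp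
  next
    have "(\<Sum>l\<in>{1..k}. of_bool (l \<in> \<Lambda>)) = card \<Lambda>"
      using card_filter_of_bool[of "{1..k}" "\<lambda>l. l \<in> \<Lambda>"] LamK by (simp add: Collect_conj_eq Int_absorb1)
    then have "(\<Sum>l\<in>{1..k}. b l) = (\<Sum>l\<in>{1..k}. b1 l) + m"
      using cL unfolding b1 sum.distrib by simp
    with sumb have "2 * (\<Sum>l\<in>{1..k}. b1 l) + 2 * m = Suc m * m" by simp
    then show "2 * (\<Sum>l\<in>{1..k}. b1 l) = m * (m - 1)" by (cases m) auto
  next
    fix l assume l: "l \<in> {1..k}"
    \<comment> \<open>The total for \<open>l\<close> drops by exactly its degree in
      \<open>G\<close>. If it was \<open>Suc m\<close>, then \<open>l\<close> is saturated and has
      degree 1; otherwise it was at most \<open>m\<close> already.\<close>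
    show "card {i \<in> {1..Suc r}. l \<in> F1 i} + 2 * b1 l + D1 l \<le> m"
      using tot[OF l] G(5)[OF l] F1c[of l] b1[of l] D1[of l] unfolding col u
      by linarith
  qed
  then obtain L' where L': "latin_array (Suc r + m) k L'" "symmetric_array (Suc r + m) L'"
      "top_left_subarray (Suc r) L1 L'"
      "\<And>l. l \<in> {1..k} \<Longrightarrow> occurrences (Suc r + m) L' l =
         occurrences (Suc r) L1 l + 2 * card {i \<in> {1..Suc r}. l \<in> F1 i} + 2 * b1 l + D1 l"
      "\<And>l. l \<in> {1..k} \<Longrightarrow> card {i \<in> {Suc r + 1..Suc r + m}. L' i i = l} = D1 l"
    by blast
  show ?case
  proof (intro exI[of _ L'] conjI ballI)
    show "latin_array (r + ?M) k L'" "symmetric_array (r + ?M) L'" using L'(1,2) by simp_all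
    show "top_left_subarray r L L'" using L'(3) by (simp add: top_left_subarray_def L1_def)
    fix l assume l: "l \<in> {1..k}"
    have "occurrences (Suc r) L1 l = occurrences r L l + 2 * u l + of_bool (l = s 0)"
      unfolding u_def by (subst occurrences_Suc[of r L1 L s]) (auto simp: L1_def)
    then show "occurrences (r + ?M) L' l =
         occurrences r L l + 2 * card {i \<in> {1..r}. l \<in> F i} + 2 * b l + D l"
      using L'(4)[OF l] F1c[of l] b1[of l] D1[of l] by simp
    have "card {i \<in> {Suc r..Suc r + m}. L' i i = l} =
        of_bool (L' (Suc r) (Suc r) = l) + card {i \<in> {Suc (Suc r)..Suc r + m}. L' i i = l}"
      unfolding card_filter_of_bool[OF finite_atLeastAtMost]
      by (rule sum.atLeast_Suc_atMost) simp
    moreover have "L' (Suc r) (Suc r) = s 0" using L'(3) by (simp add: top_left_subarray_def L1_def)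
    ultimately show "card {i \<in> {r + 1..r + ?M}. L' i i = l} = D l"
      using L'(5)[OF l] D1[of l] by auto
  qed
qed

section \<open>Choosing the symbols that continue each row\<close>

lemma sum_card_swap:
  "finite I \<Longrightarrow> finite K \<Longrightarrow>
    (\<Sum>i\<in>I. card {l \<in> K. R i l}) = (\<Sum>l\<in>K. card {i \<in> I. R i l})"
  by (simp only: card_filter_of_bool) (rule sum.swap)

lemma card_filter_pairs:
  assumes "finite I" and "finite K"
  shows "card {(i, l). i \<in> I \<and> l \<in> K \<and> R i l} = (\<Sum>i\<in>I. card {l \<in> K. R i l})"
proof -
  have "{(i, l). i \<in> I \<and> l \<in> K \<and> R i l} = Sigma I (\<lambda>i. {l \<in> K. R i l})" by auto
  then show ?thesis using assms by simp
qed

text \<open>In the bipartite graph joining each row to the symbols it misses,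
  \<open>rows_missing\<close> and \<open>symbols_missing\<close> are degrees, and both sums of them
  count the edges between \<open>I\<close> and \<open>K\<close>. The two cut conditions of
  \<open>degree_constrained_subgraph\<close> then follow from \<open>bound\<close> at
  \<open>I = {1..r}\<close> and at \<open>K = {1..k}\<close> respectively.\<close>

lemma row_selection:
  fixes M :: int and lo up :: "nat \<Rightarrow> int"
  assumes lo_up: "\<And>l. l \<in> {1..k} \<Longrightarrow> lo l \<le> up l"
    and bound: "\<And>I K. I \<subseteq> {1..r} \<Longrightarrow> K \<subseteq> {1..k} \<Longrightarrow>
      (\<Sum>l\<in>K. max 0 (lo l - int (rows_missing r L I l)))
        + (\<Sum>i\<in>I. max 0 (M - int (symbols_missing r L K i)))
      \<le> M * (int r - int (card I)) + (\<Sum>l\<in>{1..k} - K. up l)"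
  shows "\<exists>F. (\<forall>i\<in>{1..r}. F i \<subseteq> {1..k} \<and> int (card (F i)) = M \<and> (\<forall>j\<in>{1..r}. L i j \<notin> F i)) \<and>
    (\<forall>l\<in>{1..k}. lo l \<le> int (card {i \<in> {1..r}. l \<in> F i}) \<and> int (card {i \<in> {1..r}. l \<in> F i}) \<le> up l)"
proof -
  define missing where "missing i l \<longleftrightarrow> (\<forall>j\<in>{1..r}. L i j \<noteq> l)" for i l
  define E where "E = {(i, l). i \<in> {1..r} \<and> l \<in> {1..k} \<and> missing i l}"
  have Esub: "E \<subseteq> {1..r} \<times> {1..k}" by (auto simp: E_def)
  then have finE: "finite E" by (rule finite_subset) simp
  have rows: "rows_missing r L I l = card {i \<in> I. missing i l}" for I l
    by (simp add: rows_missing_def missing_def)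
  have syms: "symbols_missing r L K i = card {l \<in> K. missing i l}" for K i
    by (simp add: symbols_missing_def missing_def)
  have EIK: "card (E \<inter> I \<times> K) = (\<Sum>i\<in>I. symbols_missing r L K i)"
    "card (E \<inter> I \<times> K) = (\<Sum>l\<in>K. rows_missing r L I l)"
    if "I \<subseteq> {1..r}" "K \<subseteq> {1..k}" for I K
  proof -
    have fin: "finite I" "finite K" using that finite_subset by blast+
    have "E \<inter> I \<times> K = {(i, l). i \<in> I \<and> l \<in> K \<and> missing i l}"
      using that by (auto simp: E_def)
    then show "card (E \<inter> I \<times> K) = (\<Sum>i\<in>I. symbols_missing r L K i)"
      by (simp only: syms card_filter_pairs[OF fin])
    then show "card (E \<inter> I \<times> K) = (\<Sum>l\<in>K. rows_missing r L I l)"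
      by (simp only: syms rows sum_card_swap[OF fin])
  qed
  have "\<exists>G\<subseteq>E. (\<forall>i\<in>{1..r}. int (card {l. (i, l) \<in> G}) = M) \<and>
     (\<forall>l\<in>{1..k}. lo l \<le> int (card {i. (i, l) \<in> G}) \<and> int (card {i. (i, l) \<in> G}) \<le> up l)"
  proof (rule degree_constrained_subgraph[OF finE _ _ Esub lo_up])
    fix I K assume s: "I \<subseteq> {1..r}" "K \<subseteq> {1..k}"
    \<comment> \<open>Positive parts allow the sum to be extended from \<open>I\<close> to all rows,
      where the term \<open>M * (int r - int (card I))\<close> of \<open>bound\<close> vanishes. The
      second condition extends \<open>K\<close> to all symbols in the same way.\<close>
    have "(\<Sum>i\<in>I. M - int (symbols_missing r L K i))
        \<le> (\<Sum>i\<in>I. max 0 (M - int (symbols_missing r L K i)))"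
      by (intro sum_mono) simp
    also have "\<dots> \<le> (\<Sum>i\<in>{1..r}. max 0 (M - int (symbols_missing r L K i)))"
      using s by (intro sum_mono2) auto
    also have "\<dots> \<le> (\<Sum>l\<in>{1..k} - K. up l)"
    proof -
      have "0 \<le> (\<Sum>l\<in>K. max 0 (lo l - int (rows_missing r L {1..r} l)))"
        by (intro sum_nonneg) simp
      then show ?thesis using bound[OF subset_refl s(2)] by simp
    qed
    finally show "(\<Sum>i\<in>I. M) \<le> int (card (E \<inter> I \<times> K)) + (\<Sum>l\<in>{1..k} - K. up l)"
      unfolding EIK(1)[OF s] by (simp add: sum_subtractf)
  next
    fix I K assume s: "I \<subseteq> {1..r}" "K \<subseteq> {1..k}"
    have fI: "finite I" using s(1) by (rule finite_subset) simp
    have "(\<Sum>l\<in>K. lo l - int (rows_missing r L I l))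
        \<le> (\<Sum>l\<in>K. max 0 (lo l - int (rows_missing r L I l)))"
      by (intro sum_mono) simp
    also have "\<dots> \<le> (\<Sum>l\<in>{1..k}. max 0 (lo l - int (rows_missing r L I l)))"
      using s by (intro sum_mono2) auto
    also have "\<dots> \<le> M * (int r - int (card I))"
    proof -
      have "0 \<le> (\<Sum>i\<in>I. max 0 (M - int (symbols_missing r L {1..k} i)))"
        by (intro sum_nonneg) simp
      then show ?thesis using bound[OF s(1) subset_refl] by simp
    qed
    also have "int r - int (card I) = int (card ({1..r} - I))"
      using s(1) fI card_mono[OF _ s(1)] by (simp add: card_Diff_subset)
    finally show "sum lo K \<le> (\<Sum>i\<in>{1..r} - I. M) + int (card (E \<inter> I \<times> K))"
      unfolding EIK(2)[OF s] by (simp add: sum_subtractf mult.commute)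
  qed simp_all
  then obtain G where G: "G \<subseteq> E" "\<forall>i\<in>{1..r}. int (card {l. (i, l) \<in> G}) = M"
     "\<forall>l\<in>{1..k}. lo l \<le> int (card {i. (i, l) \<in> G}) \<and> int (card {i. (i, l) \<in> G}) \<le> up l"
    by (elim exE conjE)
  have "{i \<in> {1..r}. l \<in> {l. (i, l) \<in> G}} = {i. (i, l) \<in> G}" for l
    using G(1) by (auto simp: E_def)
  moreover have "{l. (i, l) \<in> G} \<subseteq> {1..k}" "\<forall>j\<in>{1..r}. L i j \<notin> {l. (i, l) \<in> G}" for i
    using G(1) by (auto simp: E_def missing_def)
  ultimately show ?thesis
    using G(2,3) by (intro exI[of _ "\<lambda>i. {l. (i, l) \<in> G}"]) simp
qed

text \<open>Two double counts. Of the rows whose set contains \<open>l\<close>, at most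
  \<open>rows_missing r L I l\<close> lie in \<open>I\<close>, so the first sum is covered by
  choices made in rows outside \<open>I\<close>, which hold \<open>M\<close> each. Dually, the
  second sum is covered by choices of symbols outside \<open>K\<close> in rows of \<open>I\<close>,
  at most \<open>up l\<close> for each \<open>l\<close>.\<close>

lemma row_selection_bound:
  fixes M :: int and lo up :: "nat \<Rightarrow> int"
  assumes F: "\<And>i. i \<in> {1..r} \<Longrightarrow> F i \<subseteq> {1..k}" "\<And>i. i \<in> {1..r} \<Longrightarrow> int (card (F i)) = M"
      "\<And>i j. i \<in> {1..r} \<Longrightarrow> j \<in> {1..r} \<Longrightarrow> L i j \<notin> F i"
    and lo: "\<And>l. l \<in> {1..k} \<Longrightarrow> lo l \<le> int (card {i \<in> {1..r}. l \<in> F i})"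
    and up: "\<And>l. l \<in> {1..k} \<Longrightarrow> int (card {i \<in> {1..r}. l \<in> F i}) \<le> up l"
    and I: "I \<subseteq> {1..r}" and K: "K \<subseteq> {1..k}"
  shows "(\<Sum>l\<in>K. max 0 (lo l - int (rows_missing r L I l)))
        + (\<Sum>i\<in>I. max 0 (M - int (symbols_missing r L K i)))
      \<le> M * (int r - int (card I)) + (\<Sum>l\<in>{1..k} - K. up l)"
proof -
  have fin: "finite I" "finite K" using I K finite_subset by blast+
  have "(\<Sum>l\<in>K. max 0 (lo l - int (rows_missing r L I l)))
      \<le> (\<Sum>l\<in>K. int (card {i \<in> {1..r} - I. l \<in> F i}))"
  proof (rule sum_mono)
    fix l assume "l \<in> K"
    then have l: "l \<in> {1..k}" using K by auto
    have "card {i \<in> {1..r}. l \<in> F i} = card {i \<in> I. l \<in> F i} + card {i \<in> {1..r} - I. l \<in> F i}"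
      using I fin by (subst card_Un_disjoint[symmetric]) (auto intro!: arg_cong[where f = card])
    moreover have "card {i \<in> I. l \<in> F i} \<le> rows_missing r L I l"
      unfolding rows_missing_def using F(3) I fin by (intro card_mono) auto
    ultimately show "max 0 (lo l - int (rows_missing r L I l)) \<le> int (card {i \<in> {1..r} - I. l \<in> F i})"
      using lo[OF l] by simp
  qed
  also have "\<dots> = (\<Sum>i\<in>{1..r} - I. int (card {l \<in> K. l \<in> F i}))"
    using sum_card_swap[of "{1..r} - I" K "\<lambda>i l. l \<in> F i"] fin
    by (simp flip: of_nat_sum)
  also have "\<dots> \<le> (\<Sum>i\<in>{1..r} - I. M)"
  proof (rule sum_mono)
    fix i assume i: "i \<in> {1..r} - I"
    then have "finite (F i)" using F(1)[of i] by (meson DiffD1 finite_atLeastAtMost finite_subset)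
    then have "card {l \<in> K. l \<in> F i} \<le> card (F i)" by (intro card_mono) auto
    then show "int (card {l \<in> K. l \<in> F i}) \<le> M" using F(2)[of i] i by simp
  qed
  also have "\<dots> = M * (int r - int (card I))"
    using I fin card_mono[OF _ I] by (simp add: card_Diff_subset mult.commute)
  finally have 1: "(\<Sum>l\<in>K. max 0 (lo l - int (rows_missing r L I l))) \<le> M * (int r - int (card I))" .
  have "(\<Sum>i\<in>I. max 0 (M - int (symbols_missing r L K i)))
      \<le> (\<Sum>i\<in>I. int (card {l \<in> {1..k} - K. l \<in> F i}))"
  proof (rule sum_mono)
    fix i assume i: "i \<in> I"
    then have ir: "i \<in> {1..r}" using I by auto
    have "card (F i) = card {l \<in> K. l \<in> F i} + card {l \<in> {1..k} - K. l \<in> F i}"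
      using K fin F(1)[OF ir] by (subst card_Un_disjoint[symmetric]) (auto intro!: arg_cong[where f = card])
    moreover have "card {l \<in> K. l \<in> F i} \<le> symbols_missing r L K i"
      unfolding symbols_missing_def using F(3)[OF ir] fin by (intro card_mono) auto
    ultimately show "max 0 (M - int (symbols_missing r L K i)) \<le> int (card {l \<in> {1..k} - K. l \<in> F i})"
      using F(2)[OF ir] by simp
  qed
  also have "\<dots> = (\<Sum>l\<in>{1..k} - K. int (card {i \<in> I. l \<in> F i}))"
    using sum_card_swap[of I "{1..k} - K" "\<lambda>i l. l \<in> F i"] fin
    by (simp flip: of_nat_sum)
  also have "\<dots> \<le> (\<Sum>l\<in>{1..k} - K. up l)"
  proof (rule sum_mono)
    fix l assume l: "l \<in> {1..k} - K"
    have "card {i \<in> I. l \<in> F i} \<le> card {i \<in> {1..r}. l \<in> F i}"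
      using I by (intro card_mono) auto
    then show "int (card {i \<in> I. l \<in> F i}) \<le> up l" using up[of l] l by simp
  qed
  finally show ?thesis using 1 by linarith
qed

section \<open>Counting and parity\<close>

text \<open>A greedy choice. It serves to decide how many pairs of cells of each symbol are moved
  onto the diagonal.\<close>

lemma exists_bounded_sum:
  fixes x :: "'a \<Rightarrow> nat"
  assumes "finite S" and "s \<le> sum x S"
  shows "\<exists>y. (\<forall>l\<in>S. y l \<le> x l) \<and> sum y S = s"
  using assms
proof (induction S arbitrary: s rule: finite_induct)
  case empty
  then show ?case by simp
next
  case (insert a S)
  have "s - min s (x a) \<le> sum x S" using insert by auto
  from insert.IH[OF this] obtain y where y: "\<forall>l\<in>S. y l \<le> x l" "sum y S = s - min s (x a)"
    by (elim exE conjE)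
  have "(\<Sum>l\<in>S. if l = a then min s (x a) else y l) = sum y S"
    using insert.hyps by (intro sum.cong) auto
  then have "sum (\<lambda>l. if l = a then min s (x a) else y l) (insert a S) = s"
    using y(2) insert.hyps by simp
  then show ?case
    using y(1) by (intro exI[of _ "\<lambda>l. if l = a then min s (x a) else y l"]) auto
qed

lemma sum_occurrences:
  assumes "latin_array m k A"
  shows "(\<Sum>l\<in>{1..k}. occurrences m A l) = m\<^sup>2"
proof -
  have "(\<Sum>l\<in>{1..k}. occurrences m A l) = (\<Sum>i\<in>{1..m}. \<Sum>j\<in>{1..m}. \<Sum>l\<in>{1..k}. of_bool (A i j = l))"
    unfolding occurrences_sum
    by (subst sum.swap, rule sum.cong[OF refl], rule sum.swap)
  also have "\<dots> = (\<Sum>i\<in>{1..m}. \<Sum>j\<in>{1..m}. 1)"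
  proof (intro sum.cong refl)
    fix i j assume "i \<in> {1..m}" "j \<in> {1..m}"
    then have "A i j \<in> {1..k}" using assms unfolding latin_array_def by blast
    then show "(\<Sum>l\<in>{1..k}. of_bool (A i j = l)) = (1::nat)"
      by (simp add: of_bool_def sum.delta)
  qed
  finally show ?thesis by (simp add: power2_eq_square)
qed

text \<open>Off-diagonal entries cancel modulo 2 in pairs. For a symbol in a symmetric block, its
  number of cells therefore has the parity of its number of diagonal cells.\<close>

lemma even_symmetric_sum_minus_diagonal:
  fixes f :: "'a \<Rightarrow> 'a \<Rightarrow> int"
  assumes "finite T" and "\<And>i j. i \<in> T \<Longrightarrow> j \<in> T \<Longrightarrow> f i j = f j i"
  shows "even ((\<Sum>i\<in>T. \<Sum>j\<in>T. f i j) - (\<Sum>i\<in>T. f i i))"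
  using assms
proof (induction T rule: finite_induct)
  case empty
  then show ?case by simp
next
  case (insert x T)
  have eq: "(\<Sum>i\<in>T. f i x) = (\<Sum>i\<in>T. f x i)"
    using insert.prems by (intro sum.cong) auto
  have "even ((\<Sum>i\<in>T. \<Sum>j\<in>T. f i j) - (\<Sum>i\<in>T. f i i))"
    by (rule insert.IH) (rule insert.prems; simp)
  moreover have "(\<Sum>i\<in>insert x T. \<Sum>j\<in>insert x T. f i j) - (\<Sum>i\<in>insert x T. f i i) =
      (\<Sum>i\<in>T. \<Sum>j\<in>T. f i j) - (\<Sum>i\<in>T. f i i) + 2 * (\<Sum>i\<in>T. f x i)"
    using insert.hyps by (simp add: sum.distrib eq)
  ultimately show ?case by simp
qed

text \<open>Taking 1 off each odd term leaves only even terms. This supplies the last congruence of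
  \<open>admissible\<close>.\<close>

lemma even_sum_minus_card_odd:
  fixes x :: "'a \<Rightarrow> int"
  assumes "finite S"
  shows "even (sum x S - int (card {l \<in> S. odd (x l)}))"
proof -
  have "sum x S - int (card {l \<in> S. odd (x l)}) = (\<Sum>l\<in>S. x l - of_bool (odd (x l)))"
    unfolding card_filter_of_bool[OF assms] sum_subtractf by simp
  also have "even \<dots>" by (intro dvd_sum) simp
  finally show ?thesis .
qed

lemma sum_of_bool_inj:
  assumes "finite S" and "inj_on f S"
  shows "(\<Sum>j\<in>S. of_bool (f j = l)) = (of_bool (l \<in> f ` S) :: nat)"
proof -
  have "(\<Sum>j\<in>S. of_bool (f j = l)) = (\<Sum>y\<in>f ` S. of_bool (y = l) :: nat)"
    using assms(2) by (simp only: sum.reindex comp_def)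
  also have "\<dots> = of_bool (l \<in> f ` S)"
    using assms(1) by (simp add: of_bool_def sum.delta)
  finally show ?thesis .
qed

text \<open>The square is cut into four blocks. By injectivity of rows \<open>a l\<close> also
  counts the cells holding \<open>l\<close> in the top right block, and by symmetry those in the
  bottom left one; \<open>c l\<close> counts the bottom right block.\<close>

lemma completion_counts:
  assumes lat: "latin_array n k L'" and sym: "symmetric_array n L'" and tl: "top_left_subarray r L L'"
    and rn: "r \<le> n"
  defines "T \<equiv> {r + 1..n}"
  defines "a l \<equiv> card {i \<in> {1..r}. l \<in> L' i ` T}"
  defines "c l \<equiv> (\<Sum>i\<in>T. \<Sum>j\<in>T. of_bool (L' i j = l))"
  defines "D l \<equiv> card {i \<in> T. L' i i = l}"
  shows "occurrences n L' l = occurrences r L l + 2 * a l + c l"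
    and "a l + c l \<le> n - r" and "D l \<le> c l" and "even (int (c l) - int (D l))"
    and "(\<Sum>l\<in>{1..k}. D l) = n - r"
proof -
  define R where "R = {1..r}"
  have nRT: "{1..n} = R \<union> T" "R \<inter> T = {}" "finite R" "finite T" and cT: "card T = n - r"
    using rn by (auto simp: R_def T_def)
  have split: "(\<Sum>i\<in>{1..n}. h i) = (\<Sum>i\<in>R. h i) + (\<Sum>i\<in>T. h i)" for h :: "nat \<Rightarrow> nat"
    unfolding nRT(1) using nRT by (intro sum.union_disjoint)
  have T: "T \<subseteq> {1..n}" and R: "R \<subseteq> {1..n}" using nRT(1) by blast+
  have sym': "L' i j = L' j i" if "i \<in> {1..n}" "j \<in> {1..n}" for i j
    using sym that unfolding symmetric_array_def by blast
  have inj: "inj_on (L' i) {1..n}" "inj_on (\<lambda>j. L' j i) {1..n}" if "i \<in> {1..n}" for i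
    using lat that unfolding latin_array_iff by blast+
  have aRT: "a l = (\<Sum>i\<in>R. \<Sum>j\<in>T. of_bool (L' i j = l))"
    unfolding a_def R_def card_filter_of_bool[OF finite_atLeastAtMost]
  proof (rule sum.cong[OF refl])
    fix i assume "i \<in> {1..r}"
    then have "inj_on (L' i) T" using inj(1)[of i] T R inj_on_subset unfolding R_def by blast
    then show "of_bool (l \<in> L' i ` T) = (\<Sum>j\<in>T. of_bool (L' i j = l) :: nat)"
      by (rule sum_of_bool_inj[OF nRT(4), symmetric])
  qed
  have aTR: "a l = (\<Sum>i\<in>T. \<Sum>j\<in>R. of_bool (L' i j = l))"
    unfolding aRT by (subst sum.swap) (use sym' T R in \<open>auto intro!: sum.cong simp: subset_iff\<close>)
  have "occurrences r L l = (\<Sum>i\<in>R. \<Sum>j\<in>R. of_bool (L' i j = l))"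
    unfolding occurrences_sum R_def using tl
    by (intro sum.cong refl) (simp add: top_left_subarray_def)
  then show "occurrences n L' l = occurrences r L l + 2 * a l + c l"
    unfolding occurrences_sum[of n] split sum.distrib using aRT aTR by (simp add: c_def)
  \<comment> \<open>The bottom left and bottom right blocks together form the rows in
    \<open>T\<close>, each containing \<open>l\<close> at most once.\<close>
  have "a l + c l = (\<Sum>i\<in>T. \<Sum>j\<in>{1..n}. of_bool (L' i j = l))"
    unfolding split sum.distrib by (simp add: aTR c_def)
  also have "\<dots> \<le> (\<Sum>i\<in>T. 1)"
  proof (rule sum_mono)
    fix i assume "i \<in> T"
    then have "inj_on (L' i) {1..n}" using T by (intro inj(1)) blast
    from sum_of_bool_inj[OF _ this, of l]
    show "(\<Sum>j\<in>{1..n}. of_bool (L' i j = l)) \<le> (1::nat)" by simp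
  qed
  finally show "a l + c l \<le> n - r" using cT by simp
  show "D l \<le> c l"
    unfolding D_def c_def card_filter_of_bool[OF nRT(4)]
  proof (rule sum_mono)
    fix i assume "i \<in> T"
    then show "of_bool (L' i i = l) \<le> (\<Sum>j\<in>T. of_bool (L' i j = l) :: nat)"
      using nRT(4) by (intro member_le_sum) simp_all
  qed
  have "even ((\<Sum>i\<in>T. \<Sum>j\<in>T. of_bool (L' i j = l)) - (\<Sum>i\<in>T. of_bool (L' i i = l) :: int))"
    using sym' T by (intro even_symmetric_sum_minus_diagonal nRT(4)) (metis subsetD)
  then show "even (int (c l) - int (D l))"
    unfolding D_def c_def card_filter_of_bool[OF nRT(4)] by simp
  have "(\<Sum>l\<in>{1..k}. D l) = (\<Sum>i\<in>T. card {l \<in> {1..k}. L' i i = l})"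
    unfolding D_def using nRT(4) by (intro sum_card_swap[symmetric]) simp_all
  also have "\<dots> = (\<Sum>i\<in>T. 1)"
  proof (rule sum.cong[OF refl])
    fix i assume "i \<in> T"
    then have "L' i i \<in> {1..k}" using lat T unfolding latin_array_def by blast
    then have "{l \<in> {1..k}. L' i i = l} = {L' i i}" by auto
    then show "card {l \<in> {1..k}. L' i i = l} = 1" by simp
  qed
  finally show "(\<Sum>l\<in>{1..k}. D l) = n - r" using cT by simp
qed

section \<open>Admissibility and the two directions of the characterization\<close>

lemma admissible_iff:
  "admissible n k r \<rho> d L \<longleftrightarrow>
    (\<forall>l\<in>{1..k}. int (\<rho> l) - int (occurrences r L l) + int (d l) \<le> 2 * (int n - int r)) \<and>
    int (card {l \<in> {1..k}. odd (int (\<rho> l) - int (occurrences r L l) - int (d l))})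
      \<le> int n - int r - (\<Sum>l\<in>{1..k}. int (d l)) \<and>
    even (int n - int r - (\<Sum>l\<in>{1..k}. int (d l))
      - (\<Sum>l\<in>{1..k}. int (\<rho> l) - int (occurrences r L l) - int (d l))) \<and>
    even ((\<Sum>l\<in>{1..k}. int (\<rho> l) - int (occurrences r L l) - int (d l))
      - int (card {l \<in> {1..k}. odd (int (\<rho> l) - int (occurrences r L l) - int (d l))}))"
  unfolding admissible_def odd_symbols_def cong_iff_dvd_diff ..

theorem theorem1p4:
  fixes n k r :: nat and \<rho> d :: "nat \<Rightarrow> nat" and L :: array
  assumes "0 < n" and "0 < k" and "r < n" and "n \<le> k"
    and "\<And>l. l \<in> {1..k} \<Longrightarrow> 1 \<le> \<rho> l \<and> \<rho> l \<le> n"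
    and "(\<Sum>l\<in>{1..k}. \<rho> l) = n\<^sup>2"
    and "(\<Sum>l\<in>{1..k}. d l) \<le> n - r"
    and "rho_latin_rectangle r k \<rho> L" and "symmetric_array r L"
  shows "(\<exists>L'. rho_latin_square n k \<rho> L' \<and> symmetric_array n L' \<and>
             top_left_subarray r L L' \<and> prescribed_diagonal_tail n k r d L')
     \<longleftrightarrow>
         admissible n k r \<rho> d L \<and>
         (\<forall>I K. I \<subseteq> {1..r} \<longrightarrow> K \<subseteq> {1..k} \<longrightarrow>
            (int n - int r) * (int r - int (card I))
              + (\<Sum>l\<in>{1..k} - K. (int (\<rho> l) - int (occurrences r L l) - int (d l)) div 2)
            \<ge> (\<Sum>l\<in>K. max 0 (int (\<rho> l) - int (occurrences r L l) - int n + int r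
                              - int (rows_missing r L I l)))
              + (\<Sum>i\<in>I. max 0 (int n - int r - int (symbols_missing r L K i))))"
proof -
  define e where "e = occurrences r L"
  define M where "M = int n - int r"
  define q where "q l = int (\<rho> l) - int (e l) - int (d l)" for l
  define Odd where "Odd = {l \<in> {1..k}. odd (q l)}"
  define lo where "lo l = int (\<rho> l) - int (e l) - int n + int r" for l
  have latL: "latin_array r k L" and symL: "symmetric_array r L"
    using assms(8,9) by (simp_all add: rho_latin_rectangle_def)
  have M1: "1 \<le> M" and Mnat: "int (n - r) = M" using assms(3) by (simp_all add: M_def)
  have "(\<Sum>l\<in>{1..k}. int (\<rho> l)) = (int n)\<^sup>2"
    using assms(6) by (simp flip: of_nat_sum of_nat_power)
  moreover have "(\<Sum>l\<in>{1..k}. int (e l)) = (int r)\<^sup>2"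
    using sum_occurrences[OF latL] by (simp add: e_def flip: of_nat_sum of_nat_power)
  ultimately have sum_re: "(\<Sum>l\<in>{1..k}. int (\<rho> l) - int (e l)) = M * (int n + int r)"
    by (simp add: sum_subtractf M_def power2_eq_square algebra_simps)
  have adm: "admissible n k r \<rho> d L \<longleftrightarrow>
    (\<forall>l\<in>{1..k}. int (\<rho> l) - int (e l) + int (d l) \<le> 2 * M) \<and>
    int (card Odd) \<le> M - (\<Sum>l\<in>{1..k}. int (d l)) \<and>
    even (M - (\<Sum>l\<in>{1..k}. int (d l)) - sum q {1..k}) \<and> even (sum q {1..k} - int (card Odd))"
    unfolding admissible_iff e_def M_def q_def Odd_def ..
  have bound_iff: "(int n - int r) * (int r - int (card I))
              + (\<Sum>l\<in>{1..k} - K. (int (\<rho> l) - int (occurrences r L l) - int (d l)) div 2)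
            \<ge> (\<Sum>l\<in>K. max 0 (int (\<rho> l) - int (occurrences r L l) - int n + int r
                              - int (rows_missing r L I l)))
              + (\<Sum>i\<in>I. max 0 (int n - int r - int (symbols_missing r L K i)))
      \<longleftrightarrow> (\<Sum>l\<in>K. max 0 (lo l - int (rows_missing r L I l)))
        + (\<Sum>i\<in>I. max 0 (M - int (symbols_missing r L K i)))
      \<le> M * (int r - int (card I)) + (\<Sum>l\<in>{1..k} - K. q l div 2)" for I K
    unfolding M_def q_def lo_def e_def ..
  show ?thesis unfolding bound_iff
  proof (intro iffI)
    assume "\<exists>L'. rho_latin_square n k \<rho> L' \<and> symmetric_array n L' \<and>
             top_left_subarray r L L' \<and> prescribed_diagonal_tail n k r d L'"
    then obtain L' where rls: "rho_latin_square n k \<rho> L'" and symL': "symmetric_array n L'"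
      and tl: "top_left_subarray r L L'" and tail: "prescribed_diagonal_tail n k r d L'"
      by (elim exE conjE)
    have lat: "latin_array n k L'" using rls by (simp add: rho_latin_square_def)
    define T where "T = {r + 1..n}"
    define F where "F i = L' i ` T" for i
    define a where "a l = card {i \<in> {1..r}. l \<in> F i}" for l
    define c where "c l = (\<Sum>i\<in>T. \<Sum>j\<in>T. of_bool (L' i j = l) :: nat)" for l
    define D where "D l = card {i \<in> T. L' i i = l}" for l
    note cc = completion_counts[OF lat symL' tl less_imp_le[OF assms(3)],
        folded T_def, folded F_def, folded a_def c_def D_def]
    have occ: "int (\<rho> l) - int (e l) = 2 * int (a l) + int (c l)" if "l \<in> {1..k}" for l
      using cc(1)[of l] rls that by (simp add: rho_latin_square_def e_def)
    have ac: "int (a l) + int (c l) \<le> M" for l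
      using cc(2)[of l] Mnat by linarith
    have dD: "d l \<le> D l" if "l \<in> {1..k}" for l
      using tail that by (simp add: prescribed_diagonal_tail_def D_def T_def)
    have sumD: "(\<Sum>l\<in>{1..k}. int (D l)) = M"
      using cc(5) Mnat by (simp flip: of_nat_sum)
    have "sum q {1..k} = M * (int n + int r) - (\<Sum>l\<in>{1..k}. int (d l))"
      unfolding q_def sum_re[symmetric] by (rule sum_subtractf)
    \<comment> \<open>With \<open>n = M + r\<close> the difference is, up to sign, a product of two
      integers of opposite parity.\<close>
    then have "M - (\<Sum>l\<in>{1..k}. int (d l)) - sum q {1..k} = - (M * (M + 2 * int r - 1))"
      by (simp add: M_def algebra_simps)
    then have par: "even (M - (\<Sum>l\<in>{1..k}. int (d l)) - sum q {1..k})"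
      by simp
    \<comment> \<open>Since \<open>c l - D l\<close> is even, an odd \<open>q l\<close> makes
      \<open>D l - d l\<close> odd. Each such symbol thus takes a diagonal cell beyond the
      prescribed ones, and there are only \<open>M\<close> diagonal cells.\<close>
    have "(\<Sum>l\<in>{1..k}. int (d l) + of_bool (odd (q l))) \<le> (\<Sum>l\<in>{1..k}. int (D l))"
    proof (rule sum_mono)
      fix l assume l: "l \<in> {1..k}"
      have "q l = 2 * int (a l) + (int (c l) - int (D l)) + (int (D l) - int (d l))"
        using occ[OF l] by (simp add: q_def)
      then have "odd (q l) \<Longrightarrow> d l \<noteq> D l" using cc(4)[of l] by auto
      then show "int (d l) + of_bool (odd (q l)) \<le> int (D l)" using dD[OF l] by auto
    qed
    then have few: "int (card Odd) \<le> M - (\<Sum>l\<in>{1..k}. int (d l))"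
      unfolding Odd_def card_filter_of_bool[OF finite_atLeastAtMost] sum.distrib sumD by simp
    \<comment> \<open>The left side is \<open>2 * a l + c l + d l\<close>, at most
      \<open>2 * (a l + c l)\<close> because \<open>d l <= D l <= c l\<close>.\<close>
    have "int (\<rho> l) - int (e l) + int (d l) \<le> 2 * M" if "l \<in> {1..k}" for l
      using occ[OF that] ac[of l] dD[OF that] cc(3)[of l] by linarith
    then have "admissible n k r \<rho> d L"
      unfolding adm Odd_def using few par even_sum_minus_card_odd[of "{1..k}" q]
      by (simp add: Odd_def)
    moreover have "(\<Sum>l\<in>K. max 0 (lo l - int (rows_missing r L I l)))
        + (\<Sum>i\<in>I. max 0 (M - int (symbols_missing r L K i)))
      \<le> M * (int r - int (card I)) + (\<Sum>l\<in>{1..k} - K. q l div 2)"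
      if "I \<subseteq> {1..r}" "K \<subseteq> {1..k}" for I K
    proof (rule row_selection_bound[where F = F, OF _ _ _ _ _ that])
      fix i assume i: "i \<in> {1..r}"
      then have i': "i \<in> {1..n}" using assms(3) by simp
      then have inj: "inj_on (L' i) {1..n}" using lat by (simp add: latin_array_iff)
      show "F i \<subseteq> {1..k}"
        using lat i' unfolding F_def T_def latin_array_def by auto
      have "inj_on (L' i) T" by (rule inj_on_subset[OF inj]) (auto simp: T_def)
      then show "int (card (F i)) = M"
        unfolding F_def by (simp add: card_image T_def Mnat)
      fix j assume j: "j \<in> {1..r}"
      show "L i j \<notin> F i"
      proof
        assume "L i j \<in> F i"
        then obtain j' where j': "j' \<in> T" "L' i j = L' i j'"
          using tl i j by (auto simp: F_def top_left_subarray_def)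
        have "j = j'"
          by (rule inj_onD[OF inj j'(2)]) (use j j'(1) assms(3) in \<open>auto simp: T_def\<close>)
        then show False using j j'(1) by (simp add: T_def)
      qed
    next
      fix l assume l: "l \<in> {1..k}"
      show "lo l \<le> int (card {i \<in> {1..r}. l \<in> F i})"
        using occ[OF l] ac[of l] unfolding a_def[symmetric] lo_def M_def by linarith
      have "2 * int (a l) \<le> q l"
        using occ[OF l] dD[OF l] cc(3)[of l] unfolding q_def by linarith
      then show "int (card {i \<in> {1..r}. l \<in> F i}) \<le> q l div 2"
        unfolding a_def[symmetric] by linarith
    qed
    ultimately show "admissible n k r \<rho> d L \<and> (\<forall>I K. I \<subseteq> {1..r} \<longrightarrow> K \<subseteq> {1..k} \<longrightarrow>
      (\<Sum>l\<in>K. max 0 (lo l - int (rows_missing r L I l)))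
        + (\<Sum>i\<in>I. max 0 (M - int (symbols_missing r L K i)))
      \<le> M * (int r - int (card I)) + (\<Sum>l\<in>{1..k} - K. q l div 2))"
      by blast
  next
    assume "admissible n k r \<rho> d L \<and> (\<forall>I K. I \<subseteq> {1..r} \<longrightarrow> K \<subseteq> {1..k} \<longrightarrow>
      (\<Sum>l\<in>K. max 0 (lo l - int (rows_missing r L I l)))
        + (\<Sum>i\<in>I. max 0 (M - int (symbols_missing r L K i)))
      \<le> M * (int r - int (card I)) + (\<Sum>l\<in>{1..k} - K. q l div 2))"
    then have adm1: "\<And>l. l \<in> {1..k} \<Longrightarrow> int (\<rho> l) - int (e l) + int (d l) \<le> 2 * M"
      and adm2: "int (card Odd) \<le> M - (\<Sum>l\<in>{1..k}. int (d l))"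
      and adm3: "even (M - (\<Sum>l\<in>{1..k}. int (d l)) - sum q {1..k})" "even (sum q {1..k} - int (card Odd))"
      and bound: "\<And>I K. I \<subseteq> {1..r} \<Longrightarrow> K \<subseteq> {1..k} \<Longrightarrow>
        (\<Sum>l\<in>K. max 0 (lo l - int (rows_missing r L I l)))
          + (\<Sum>i\<in>I. max 0 (M - int (symbols_missing r L K i)))
        \<le> M * (int r - int (card I)) + (\<Sum>l\<in>{1..k} - K. q l div 2)"
      unfolding adm by blast+
    \<comment> \<open>\<open>q l - 2 * lo l\<close> equals
      \<open>2 * M - (\<rho> l - e l + d l)\<close>, so this is the first condition of
      admissibility.\<close>
    have "lo l \<le> q l div 2" if "l \<in> {1..k}" for l
    proof -
      have "2 * lo l \<le> q l" using adm1[OF that] unfolding lo_def q_def M_def by (simp add: algebra_simps)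
      then show ?thesis by linarith
    qed
    from row_selection[OF this bound]
    obtain F where F: "\<And>i. i \<in> {1..r} \<Longrightarrow> F i \<subseteq> {1..k}" "\<And>i. i \<in> {1..r} \<Longrightarrow> int (card (F i)) = M"
        "\<And>i j. i \<in> {1..r} \<Longrightarrow> j \<in> {1..r} \<Longrightarrow> L i j \<notin> F i"
      and Fl: "\<And>l. l \<in> {1..k} \<Longrightarrow> lo l \<le> int (card {i \<in> {1..r}. l \<in> F i})"
        "\<And>l. l \<in> {1..k} \<Longrightarrow> int (card {i \<in> {1..r}. l \<in> F i}) \<le> q l div 2"
      by blast
    define a where "a l = card {i \<in> {1..r}. l \<in> F i}" for l
    define c where "c l = int (\<rho> l) - int (e l) - 2 * int (a l)" for l
    define odd_part where "odd_part l = (of_bool (odd (q l)) :: nat)" for l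
    \<comment> \<open>\<open>q l - 2 * a l\<close> is \<open>c l - d l\<close>: what
      \<open>l\<close> must still fill in the bottom right block beyond its prescribed diagonal
      cells. An odd surplus forces one more diagonal cell, and \<open>x l\<close> counts the
      remaining cells in pairs. As \<open>2 * a l <= q l\<close>, nothing is truncated by
      \<open>nat\<close>.\<close>
    define x where "x l = nat ((q l - 2 * int (a l) - int (odd_part l)) div 2)" for l
    have x: "2 * int (x l) = c l - int (d l) - int (odd_part l)" if "l \<in> {1..k}" for l
    proof -
      have "2 * int (a l) \<le> q l" using Fl(2)[OF that] unfolding a_def by linarith
      then have "0 \<le> q l - 2 * int (a l) - int (odd_part l)" "even (q l - 2 * int (a l) - int (odd_part l))"
        unfolding odd_part_def by (cases "odd (q l)"; auto elim!: oddE)+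
      then show ?thesis by (simp add: x_def c_def q_def)
    qed
    have odd_part: "(\<Sum>l\<in>{1..k}. int (odd_part l)) = int (card Odd)"
      unfolding Odd_def card_filter_of_bool[OF finite_atLeastAtMost] odd_part_def by simp
    have "(\<Sum>l\<in>{1..k}. a l) = (\<Sum>i\<in>{1..r}. card {l \<in> {1..k}. l \<in> F i})"
      unfolding a_def by (rule sum_card_swap) simp_all
    also have "\<dots> = (\<Sum>i\<in>{1..r}. n - r)"
    proof (rule sum.cong[OF refl])
      fix i assume i: "i \<in> {1..r}"
      then have "{l \<in> {1..k}. l \<in> F i} = F i" using F(1) by blast
      then show "card {l \<in> {1..k}. l \<in> F i} = n - r" using F(2)[OF i] Mnat by simp
    qed
    finally have "int (\<Sum>l\<in>{1..k}. a l) = int r * M" using Mnat by simp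
    then have "sum c {1..k} = M * (int n + int r) - 2 * (int r * M)"
      unfolding c_def sum_subtractf[of _ "\<lambda>l. 2 * int (a l)"] sum_re by (simp flip: sum_distrib_left)
    then have sumc: "sum c {1..k} = M * M" by (simp add: M_def algebra_simps)
    have "2 * (\<Sum>l\<in>{1..k}. int (x l)) = (\<Sum>l\<in>{1..k}. c l - int (d l) - int (odd_part l))"
      unfolding sum_distrib_left using x by (intro sum.cong) auto
    then have sumx: "2 * int (sum x {1..k}) = M * M - (\<Sum>l\<in>{1..k}. int (d l)) - int (card Odd)"
      unfolding sum_subtractf sumc odd_part by simp
    \<comment> \<open>The diagonal cells neither prescribed nor forced by parity are even in number;
      \<open>s\<close> of the pairs counted by \<open>x\<close> will fill them.\<close>
    have "even (M - (\<Sum>l\<in>{1..k}. int (d l)) - int (card Odd))"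
      using dvd_add[OF adm3] by (simp only: add_diff_eq diff_add_cancel)
    then obtain s' where s': "M - (\<Sum>l\<in>{1..k}. int (d l)) - int (card Odd) = 2 * s'" by (elim evenE)
    define s where "s = nat s'"
    have s: "2 * int s = M - (\<Sum>l\<in>{1..k}. int (d l)) - int (card Odd)"
      using adm2 s' unfolding s_def by simp
    \<comment> \<open>There are enough pairs, since the diagonal has no more cells than the whole
      block: \<open>2 * s\<close> and \<open>2 * sum x {1..k}\<close> arise from \<open>M\<close>
      and \<open>M * M\<close> by the same subtraction.\<close>
    have "M * 1 \<le> M * M" using M1 by (intro mult_left_mono) simp_all
    then have "s \<le> sum x {1..k}" using s sumx by linarith
    from exists_bounded_sum[OF finite_atLeastAtMost this] obtain y where
      y: "\<And>l. l \<in> {1..k} \<Longrightarrow> y l \<le> x l" "sum y {1..k} = s"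
      by blast
    \<comment> \<open>Of the pairs of \<open>l\<close>, \<open>y l\<close> are placed on the
      diagonal as two cells each, and \<open>b l\<close> become pairs of opposite off-diagonal
      cells.\<close>
    define D where "D l = d l + odd_part l + 2 * y l" for l
    define b where "b l = x l - y l" for l
    have bD: "2 * int (b l) + int (D l) = c l" if "l \<in> {1..k}" for l
      using y(1)[OF that] x[OF that] by (simp add: b_def D_def)
    have "(\<Sum>l\<in>{1..k}. int (D l)) = (\<Sum>l\<in>{1..k}. int (d l)) + int (card Odd) + 2 * int s"
      unfolding y(2)[symmetric] D_def odd_part[symmetric] by (simp add: sum.distrib sum_distrib_left)
    then have sumD: "(\<Sum>l\<in>{1..k}. int (D l)) = M" using s by simp
    have "(\<Sum>l\<in>{1..k}. 2 * int (b l) + int (D l)) = M * M"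
      unfolding sumc[symmetric] using bD by (intro sum.cong) auto
    then have sumb: "2 * (\<Sum>l\<in>{1..k}. int (b l)) = M * (M - 1)"
      unfolding sum.distrib sumD by (simp add: sum_distrib_left algebra_simps)
    have "\<exists>L'. latin_array (r + (n - r)) k L' \<and> symmetric_array (r + (n - r)) L' \<and>
      top_left_subarray r L L' \<and>
      (\<forall>l\<in>{1..k}. occurrences (r + (n - r)) L' l =
         occurrences r L l + 2 * card {i \<in> {1..r}. l \<in> F i} + 2 * b l + D l \<and>
       card {i \<in> {r + 1..r + (n - r)}. L' i i = l} = D l)"
    proof (rule symmetric_completion[OF latL symL F(1) _ F(3)])
      show "card (F i) = n - r" if "i \<in> {1..r}" for i
        using F(2)[OF that] Mnat by simp
      have "int (\<Sum>l\<in>{1..k}. D l) = int (n - r)" using sumD Mnat by simp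
      then show "(\<Sum>l\<in>{1..k}. D l) = n - r" by (simp only: of_nat_eq_iff)
      have "int (2 * (\<Sum>l\<in>{1..k}. b l)) = int ((n - r) * (n - r - 1))"
        using sumb Mnat M1 by (simp add: of_nat_diff)
      then show "2 * (\<Sum>l\<in>{1..k}. b l) = (n - r) * (n - r - 1)" by (simp only: of_nat_eq_iff)
      fix l assume l: "l \<in> {1..k}"
      \<comment> \<open>This is the lower bound \<open>lo l <= a l\<close>, rewritten by the
        definition of \<open>c\<close>: the new columns have room for \<open>l\<close>.\<close>
      have "int (a l) + c l \<le> M"
        using Fl(1)[OF l] unfolding c_def lo_def M_def a_def by linarith
      then show "card {i \<in> {1..r}. l \<in> F i} + 2 * b l + D l \<le> n - r"
        using bD[OF l] Mnat unfolding a_def by linarith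
    qed
    then obtain L' where L': "latin_array n k L'" "symmetric_array n L'" "top_left_subarray r L L'"
      "\<And>l. l \<in> {1..k} \<Longrightarrow> occurrences n L' l = e l + 2 * a l + 2 * b l + D l"
      "\<And>l. l \<in> {1..k} \<Longrightarrow> card {i \<in> {r + 1..n}. L' i i = l} = D l"
      using assms(3) by (auto simp: e_def a_def)
    have "occurrences n L' l = \<rho> l" if "l \<in> {1..k}" for l
    proof -
      have "int (occurrences n L' l) = int (\<rho> l)"
        using L'(4)[OF that] bD[OF that] by (simp add: c_def)
      then show ?thesis by (simp only: of_nat_eq_iff)
    qed
    moreover have "d l \<le> card {i \<in> {r + 1..n}. L' i i = l}" if "l \<in> {1..k}" for l
      unfolding L'(5)[OF that] D_def by simp
    ultimately show "\<exists>L'. rho_latin_square n k \<rho> L' \<and> symmetric_array n L' \<and>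
             top_left_subarray r L L' \<and> prescribed_diagonal_tail n k r d L'"
      using L'(1-3)
      by (intro exI[of _ L']) (simp add: rho_latin_square_def prescribed_diagonal_tail_def)
  qed
qed

end
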